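(* Let $\rho:[1,\infty)\to(0,1]$ be a decreasing bijection. Then for any $p\in\mathbb N$ there exists a function $F\in\mathcal F^{p,\mathrm{ncvx}}_\infty$ such that $$\limsup_{n\to\infty}\ \inf_{\mathrm A\in\mathcal A_{\mathrm{zr}}^{(p)}}\frac{n^{\frac{p}{p+1}}\,\|\nabla F(\mathrm A[F]_n)\|}{\rho(n)}\ \ge\ 1,$$ where $\mathrm A[F]_n=x^{(n+1)}$ denotes the output of $\mathrm A$ on $F$ after $n$ oracle calls.
   Context: $\mathbb N=\{1,2,\dots\}$. $\mathcal H_\infty$ is an infinite-dimensional real Hilbert space with coordinates indexed by $\mathbb N$ with respect to a fixed orthonormal basis (i.e. $\ell^2$). $f^\star:=\inf f$. Function class: $\mathcal F^{p,\mathrm{ncvx}}_\infty$ is the set of $f:\mathcal H_\infty\to\mathbb R$ that are $p$ times continuously (Fréchet) differentiable with $\|\nabla^pf(x)-\nabla^pf(y)\|\le\|x-y\|$ for all $x,y$ (operator norm on symmetric $p$-linear forms), with $-1\le f^\star\le f(\mathbf 0)\le1$ and $\|\nabla^rf(\mathbf 0)\|\le1$ for all $r\in\{1,\dots,p\}$. Support: for a vector $x$, $\operatorname{supp}\{x\}=\{j:x_j\ne0\}$; for a symmetric order-$r$ tensor $T$, $r\ge2$, $\operatorname{supp}\{T\}=\{j:T_{j,j_2,\dots,j_r}\ne0\text{ for some }j_2,\dots,j_r\}$. Zero-respecting: a sequence $x^{(1)},x^{(2)},\dots$ is $p$th-order zero-respecting with respect to $f$ (differentiable through order $p$) if for each $t\in\mathbb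 N$, $\operatorname{supp}\{x^{(t)}\}\subseteq\bigcup_{r\in\{1,\dots,p\}}\bigcup_{s<t}\operatorname{supp}\{\nabla^rf(x^{(s)})\}$ (so $x^{(1)}=\mathbf 0$). An algorithm $\mathrm A$ maps an objective $f$ to a sequence of iterates $\mathrm A[f]=\{x^{(t)}\}_{t\ge1}$; $\mathrm A\in\mathcal A_{\mathrm{zr}}^{(p)}$ if for every $f$ differentiable through order $p$ the sequence $\mathrm A[f]$ is $p$th-order zero-respecting with respect to $f$. *)

theory Defs
  imports "HOL-Analysis.Analysis"
begin

text \<open>
  The space is an arbitrary real Hilbert space (class \<^class>\<open>real_inner\<close> together with
  \<^class>\<open>complete_space\<close>) equipped with a complete orthonormal sequence \<open>e\<close>.
  The coordinates are labelled by all of \<^typ>\<open>nat\<close>, so the label \<open>i\<close> stands for the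
  \<open>(i + 1)\<close>-st coordinate.
\<close>

definition orthonormal_basis :: "(nat \<Rightarrow> 'a::real_inner) \<Rightarrow> bool" where
  "orthonormal_basis e \<longleftrightarrow>
     (\<forall>i j. e i \<bullet> e j = (if i = j then 1 else 0)) \<and> closure (span (range e)) = UNIV"

text \<open>
  A form of order \<open>r\<close> is a function on argument lists; only its values on lists of length \<open>r\<close>
  are ever used.
\<close>

definition bounded_form :: "nat \<Rightarrow> ('a::real_normed_vector list \<Rightarrow> real) \<Rightarrow> bool" where
  "bounded_form r T \<longleftrightarrow>
     (\<forall>us ws. length us + length ws + 1 = r \<longrightarrow> linear (\<lambda>v. T (us @ v # ws))) \<and>
     (\<exists>K. \<forall>vs. length vs = r \<longrightarrow> \<bar>T vs\<bar> \<le> K * prod_list (map norm vs))"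

text \<open>
  The operator norm. As a supremum of reals it is meaningful for bounded forms, and it is
  only applied to differences of bounded forms below.
\<close>

definition form_norm :: "nat \<Rightarrow> ('a::real_normed_vector list \<Rightarrow> real) \<Rightarrow> real" where
  "form_norm r T = (SUP vs\<in>{vs. length vs = r \<and> (\<forall>v\<in>set vs. norm v \<le> 1)}. \<bar>T vs\<bar>)"

text \<open>
  \<open>nabla r f x [v\<^sub>1, \<dots>, v\<^sub>r]\<close> is the value of the \<open>r\<close>-th derivative of \<open>f\<close> at \<open>x\<close> on the
  directions \<open>v\<^sub>1, \<dots>, v\<^sub>r\<close>. Since evaluation at a fixed list is a bounded linear functional
  on forms, the value of the derivative of the form-valued map \<open>nabla r f\<close> is obtained by
  differentiating the evaluated, real-valued map. Differentiability of the form-valued map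
  itself, with respect to the operator norm, is imposed by \<open>times_differentiable\<close>.
\<close>

primrec nabla :: "nat \<Rightarrow> ('a::real_normed_vector \<Rightarrow> real) \<Rightarrow> 'a \<Rightarrow> 'a list \<Rightarrow> real" where
  "nabla 0 f x vs = f x"
| "nabla (Suc r) f x vs = frechet_derivative (\<lambda>y. nabla r f y (tl vs)) (at x) (hd vs)"

definition times_differentiable :: "nat \<Rightarrow> ('a::real_normed_vector \<Rightarrow> real) \<Rightarrow> bool" where
  "times_differentiable p f \<longleftrightarrow>
     (\<forall>r\<le>p. \<forall>x. bounded_form r (nabla r f x)) \<and>
     (\<forall>r<p. \<forall>x.
        ((\<lambda>y. form_norm r (\<lambda>vs. nabla r f y vs - nabla r f x vs - nabla (Suc r) f x ((y - x) # vs))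
               / norm (y - x)) \<longlongrightarrow> 0) (at x))"

definition times_continuously_differentiable ::
    "nat \<Rightarrow> ('a::real_normed_vector \<Rightarrow> real) \<Rightarrow> bool" where
  "times_continuously_differentiable p f \<longleftrightarrow>
     times_differentiable p f \<and>
     (\<forall>x. ((\<lambda>y. form_norm p (\<lambda>vs. nabla p f y vs - nabla p f x vs)) \<longlongrightarrow> 0) (at x))"

definition F_ncvx :: "nat \<Rightarrow> ('a::real_normed_vector \<Rightarrow> real) set" where
  "F_ncvx p = {f.
     times_continuously_differentiable p f \<and>
     (\<forall>x y. form_norm p (\<lambda>vs. nabla p f x vs - nabla p f y vs) \<le> norm (x - y)) \<and>
     - 1 \<le> (INF x. ereal (f x)) \<and> (INF x. ereal (f x)) \<le> ereal (f 0) \<and> f 0 \<le> 1 \<and>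
     (\<forall>r\<in>{1..p}. form_norm r (nabla r f 0) \<le> 1)}"

definition supp :: "(nat \<Rightarrow> 'a::real_inner) \<Rightarrow> 'a \<Rightarrow> nat set" where
  "supp e x = {j. x \<bullet> e j \<noteq> 0}"

text \<open>
  The tensor entry with indices \<open>j, j\<^sub>2, \<dots>, j\<^sub>r\<close> is \<open>T [e j, e j\<^sub>2, \<dots>, e j\<^sub>r]\<close>. For \<open>r = 1\<close> and the
  first derivative of a function this is the support of its gradient vector.
\<close>

definition tensor_supp ::
    "(nat \<Rightarrow> 'a::real_inner) \<Rightarrow> nat \<Rightarrow> ('a list \<Rightarrow> real) \<Rightarrow> nat set" where
  "tensor_supp e r T = {j. \<exists>js. length (j # js) = r \<and> T (map e (j # js)) \<noteq> 0}"

text \<open>Iterates are numbered from 1; the entry of a sequence at index 0 is never used.\<close>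

definition zero_respecting ::
    "(nat \<Rightarrow> 'a::real_inner) \<Rightarrow> nat \<Rightarrow> ('a \<Rightarrow> real) \<Rightarrow> (nat \<Rightarrow> 'a) \<Rightarrow> bool" where
  "zero_respecting e p f x \<longleftrightarrow>
     (\<forall>t\<ge>1. supp e (x t) \<subseteq> (\<Union>r\<in>{1..p}. \<Union>s\<in>{1..<t}. tensor_supp e r (nabla r f (x s))))"

definition A_zr :: "(nat \<Rightarrow> 'a::real_inner) \<Rightarrow> nat \<Rightarrow> (('a \<Rightarrow> real) \<Rightarrow> nat \<Rightarrow> 'a) set" where
  "A_zr e p = {A. \<forall>f. times_differentiable p f \<longrightarrow> zero_respecting e p f (A f)}"

end

theory Submission
  imports Defs
begin

text \<open>
  The function is a sum of signed \<open>(p + 1)\<close>-st powers of positive parts of affine functionals; its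
  \<open>p\<close>-th derivative is Lipschitz because \<open>t \<mapsto> max t 0\<close> is, and the functionals form a Bessel sequence.
  The coordinates are grouped into blocks of length \<open>N k + 1\<close> and scale \<open>\<sigma> k\<close>. On a block with
  \<open>x\<^sub>-\<^sub>1 = \<sigma> k\<close> the summands penalise the descents \<open>x\<^sub>i\<^sub>-\<^sub>1 - x\<^sub>i\<close> and add a potential that pushes every
  \<open>x\<^sub>i < \<sigma> k\<close> downwards, with a force that is flat to order \<open>p\<close> at \<open>0\<close>. Flatness lets an algorithm discover
  only one coordinate of each block per oracle call, so after \<open>N k\<close> calls the last one still
  vanishes; but near-stationarity would carry the chain past \<open>0\<close> with positive momentum. Hence
  the gradient is at least of order \<open>\<sigma> k ^ p\<close>, while the block lowers the function by at most the
  order of \<open>N k * \<sigma> k ^ (p + 1)\<close>. Taking \<open>\<sigma> k ^ p\<close> proportional to \<open>\<rho> (N k) * N k powr (- p / (p + 1))\<close>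
  for a sparse sequence \<open>N k\<close> makes all these decreases summable.
\<close>

section \<open>Powers of the positive part\<close>

definition pospow :: "nat \<Rightarrow> real \<Rightarrow> real" where
  "pospow n t = max t 0 ^ n"

lemma pospow_nonneg [simp]: "0 \<le> pospow n t"
  by (simp add: pospow_def)

lemma pospow_nonpos: "t \<le> 0 \<Longrightarrow> 0 < n \<Longrightarrow> pospow n t = 0"
  by (simp add: pospow_def max_def)

lemma pospow_mono: "s \<le> t \<Longrightarrow> pospow n s \<le> pospow n t"
  unfolding pospow_def by (intro power_mono) auto

lemma pospow_scale: "0 \<le> s \<Longrightarrow> pospow n (s * t) = s ^ n * pospow n t"
proof -
  assume "0 \<le> s"
  then have "max (s * t) 0 = s * max t 0"
    using max_mult_distrib_left[of s t 0] by simp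
  then show ?thesis
    by (simp add: pospow_def power_mult_distrib)
qed

text \<open>One factor is estimated by \<open>y\<close> and the others by \<open>R\<close>. In the
  series below \<open>y\<close> varies with the summand and is square-summable, while
  \<open>R\<close> is uniform.\<close>

lemma pospow_le:
  assumes "max t 0 \<le> y" "y \<le> R" "0 < n"
  shows "pospow n t \<le> y * R ^ (n - 1)"
proof -
  have "max t 0 * max t 0 ^ (n - 1) \<le> y * R ^ (n - 1)"
    using assms by (intro mult_mono power_mono) auto
  then show ?thesis
    using assms(3) by (simp add: pospow_def power_eq_if)
qed

text \<open>For \<open>n = 0\<close> the power has a kink in its first derivative at 0, so the
  quadratic remainder rests on the Lipschitz continuity of the positive part; larger exponents
  follow by induction.\<close>

lemma pospow_taylor:
  assumes "max s 0 \<le> R" "max t 0 \<le> R"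
  shows "\<bar>pospow (n + 2) s - pospow (n + 2) t - real (n + 2) * pospow (n + 1) t * (s - t)\<bar>
           \<le> real ((n + 2)\<^sup>2) * R ^ n * (s - t)\<^sup>2"
proof -
  define a b where "a = max s 0" and "b = max t 0"
  have R: "0 \<le> R" "a \<le> R" "b \<le> R" "0 \<le> a" "0 \<le> b"
    using assms by (auto simp: a_def b_def)
  have ab: "\<bar>a - b\<bar> \<le> \<bar>s - t\<bar>"
    by (auto simp: a_def b_def max_def)
  \<comment> \<open>If \<open>t \<le> 0\<close> the factor \<open>b\<close> vanishes, and if
    \<open>s\<close> and \<open>t\<close> are both nonnegative the difference does. In the remaining
    case the difference is \<open>- s\<close>, and both \<open>t\<close> and \<open>- s\<close> are
    at most \<open>t - s\<close>.\<close>
  have key: "b * \<bar>a - b - (s - t)\<bar> \<le> (s - t)\<^sup>2"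
  proof (cases "t > 0 \<and> s < 0")
    case True
    have "t * (- s) \<le> (t - s) * (t - s)"
      using True by (intro mult_mono) auto
    then show ?thesis
      using True by (simp add: a_def b_def max_def power2_eq_square algebra_simps)
  next
    case False
    then show ?thesis
      by (auto simp: a_def b_def max_def)
  qed
  have sq: "\<bar>a - b\<bar> * \<bar>s - t\<bar> \<le> (s - t)\<^sup>2"
    using mult_right_mono[OF ab, of "\<bar>s - t\<bar>"] by (simp add: power2_eq_square)
  have "\<bar>a ^ (n + 2) - b ^ (n + 2) - real (n + 2) * b ^ (n + 1) * (s - t)\<bar>
      \<le> real ((n + 2)\<^sup>2) * R ^ n * (s - t)\<^sup>2"
  proof (induction n)
    case 0
    have "a ^ 2 - b ^ 2 - 2 * b * (s - t)
        = (a - b)\<^sup>2 + 2 * (b * (a - b - (s - t)))"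
      by (simp add: power2_eq_square algebra_simps)
    moreover have "(a - b)\<^sup>2 \<le> (s - t)\<^sup>2"
      using ab by (simp add: abs_le_square_iff)
    moreover have "\<bar>b * (a - b - (s - t))\<bar> \<le> (s - t)\<^sup>2"
      using key R by (simp add: abs_mult)
    ultimately have "\<bar>a ^ 2 - b ^ 2 - 2 * b * (s - t)\<bar> \<le> 4 * (s - t)\<^sup>2"
      using zero_le_power2[of "a - b"] by linarith
    then show ?case
      by (simp add: power2_eq_square)
  next
    case (Suc n)
    \<comment> \<open>A product rule for remainders: \<open>a\<close> times the remainder for
      \<open>n\<close>, then the error of linearising \<open>a\<close> itself, then the cross term
      of the two increments.\<close>
    have "a ^ (Suc n + 2) - b ^ (Suc n + 2) - real (Suc n + 2) * b ^ (Suc n + 1) * (s - t)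
        = a * (a ^ (n + 2) - b ^ (n + 2) - real (n + 2) * b ^ (n + 1) * (s - t))
          + b ^ (n + 1) * (b * (a - b - (s - t))) + real (n + 2) * (b ^ (n + 1) * ((a - b) * (s - t)))"
      by (simp add: algebra_simps)
    also have "\<bar>\<dots>\<bar> \<le> R * (real ((n + 2)\<^sup>2) * R ^ n * (s - t)\<^sup>2)
        + R ^ (n + 1) * (s - t)\<^sup>2 + real (n + 2) * (R ^ (n + 1) * (s - t)\<^sup>2)"
    proof -
      have "\<bar>a * (a ^ (n + 2) - b ^ (n + 2) - real (n + 2) * b ^ (n + 1) * (s - t))\<bar>
          \<le> R * (real ((n + 2)\<^sup>2) * R ^ n * (s - t)\<^sup>2)"
        unfolding abs_mult using R Suc by (intro mult_mono) auto
      moreover have bR: "\<bar>b ^ (n + 1)\<bar> \<le> R ^ (n + 1)"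
        using R by (simp only: power_abs) (intro power_mono, auto)
      then have "\<bar>b ^ (n + 1) * (b * (a - b - (s - t)))\<bar> \<le> R ^ (n + 1) * (s - t)\<^sup>2"
        unfolding abs_mult[of "b ^ (n + 1)"] using R key by (intro mult_mono) (auto simp: abs_mult)
      moreover have "\<bar>b ^ (n + 1) * ((a - b) * (s - t))\<bar> \<le> R ^ (n + 1) * (s - t)\<^sup>2"
        unfolding abs_mult[of "b ^ (n + 1)"] using R sq bR by (intro mult_mono) (auto simp: abs_mult)
      then have "\<bar>real (n + 2) * (b ^ (n + 1) * ((a - b) * (s - t)))\<bar>
          \<le> real (n + 2) * (R ^ (n + 1) * (s - t)\<^sup>2)"
        unfolding abs_mult[of "real (n + 2)"] abs_of_nat by (rule mult_left_mono) simp
      ultimately show ?thesis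
        by linarith
    qed
    also have "\<dots> = (real ((n + 2)\<^sup>2) + 1 + real (n + 2)) * (R ^ Suc n * (s - t)\<^sup>2)"
      by (simp add: algebra_simps)
    also have "\<dots> \<le> real ((Suc n + 2)\<^sup>2) * (R ^ Suc n * (s - t)\<^sup>2)"
    proof (rule mult_right_mono)
      show "real ((n + 2)\<^sup>2) + 1 + real (n + 2) \<le> real ((Suc n + 2)\<^sup>2)"
        by (simp add: power2_eq_square algebra_simps)
      show "0 \<le> R ^ Suc n * (s - t)\<^sup>2"
        using R(1) by (intro mult_nonneg_nonneg zero_le_power zero_le_power2)
    qed
    finally show ?case
      by (simp add: mult.assoc)
  qed
  then show ?thesis
    by (simp add: pospow_def a_def b_def)
qed

lemma pospow_lipschitz_1: "\<bar>pospow 1 s - pospow 1 t\<bar> \<le> \<bar>s - t\<bar>"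
  by (auto simp: pospow_def max_def)

lemma pospow_ge_iff:
  assumes "0 < n" "0 < a"
  shows "a ^ n \<le> pospow n t \<longleftrightarrow> a \<le> t"
proof -
  have "a ^ n \<le> pospow n t \<longleftrightarrow> a \<le> max t 0"
    using assms by (simp add: pospow_def power_mono_iff)
  then show ?thesis
    using assms(2) by auto
qed

section \<open>The scalar chain\<close>

text \<open>
  Read \<open>D\<close> as the downward momentum of a particle at height \<open>z\<close>. Having left height \<open>1\<close>, the
  particle picks up momentum on \<open>[1/2, 1]\<close>, loses at most \<open>\<epsilon>\<close> per step close to \<open>0\<close>, where the
  force \<open>\<bar>z\<bar>^p\<close> is weak, and therefore cannot come to rest at height \<open>0\<close>.
\<close>
lemma chain_momentum:
  fixes z :: "nat \<Rightarrow> real"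
  assumes p: "p \<ge> 1" and \<epsilon>: "\<epsilon> = (1/8) ^ p / 16" and z0: "z 0 = 1"
    and step: "\<And>i. i < n \<Longrightarrow> z (Suc i) \<le> 1 \<Longrightarrow>
      pospow p (z (Suc i) - z (Suc (Suc i))) \<ge> pospow p (z i - z (Suc i)) + \<bar>z (Suc i)\<bar> ^ p - \<epsilon>"
    and zn: "z (Suc n) = 0"
  shows "pospow p (z n - z (Suc n)) \<ge> (1/8) ^ p"
proof -
  have \<epsilon>0: "0 < \<epsilon>"
    unfolding \<epsilon> by simp
  have half: "2 * c ^ p \<le> (2 * c) ^ p" if "0 \<le> c" for c :: real
  proof -
    have "2 ^ 1 \<le> (2 ^ p :: real)"
      using p by (intro power_increasing) auto
    then show ?thesis
      using mult_right_mono[of 2 "2 ^ p" "c ^ p"] that by (simp add: power_mult_distrib)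
  qed
  have q4: "2 * (1/8) ^ p \<le> (1/4 :: real) ^ p" and q2: "2 * (1/4) ^ p \<le> (1/2 :: real) ^ p"
    using half[of "1/8"] half[of "1/4"] by simp_all
  have e16: "16 * \<epsilon> = (1/8) ^ p"
    using \<epsilon> by simp
  define m where "m i \<longleftrightarrow> z (Suc i) < 1/2 \<and>
    pospow p (z i - z (Suc i)) \<ge> (1/4) ^ p - 8 * \<epsilon> * (1/2 - max (z (Suc i)) (- 1/4))" for i
  have strong: "pospow p (z i - z (Suc i)) \<ge> (1/4) ^ p - 6 * \<epsilon>" if "m i" for i
  proof -
    have "8 * \<epsilon> * (1/2 - max (z (Suc i)) (- 1/4)) \<le> 8 * \<epsilon> * (3/4)"
      using \<epsilon>0 by (intro mult_left_mono) auto
    then show ?thesis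
      using that by (auto simp: m_def)
  qed
  have weak: "m i" if "z (Suc i) < 1/2" "pospow p (z i - z (Suc i)) \<ge> (1/4) ^ p" for i
  proof -
    have "0 \<le> 8 * \<epsilon> * (1/2 - max (z (Suc i)) (- 1/4))"
      using \<epsilon>0 that by (intro mult_nonneg_nonneg) auto
    then show ?thesis
      using that by (auto simp: m_def)
  qed
  have jump: "m i" if "z (Suc i) < 1/2" "z i \<ge> 1" for i
  proof (rule weak)
    have "(1/4) ^ p \<le> (1/2 :: real) ^ p"
      by (intro power_mono) auto
    also have "\<dots> \<le> pospow p (z i - z (Suc i))"
      using that p by (subst pospow_ge_iff) auto
    finally show "pospow p (z i - z (Suc i)) \<ge> (1/4) ^ p" .
  qed fact
  have main: "z (Suc i) \<ge> 1/2 \<or> m i" if "i \<le> n" for i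
    using that
  proof (induction i)
    case 0
    then show ?case
      using jump[of 0] z0 by linarith
  next
    case (Suc i)
    then have IH: "z (Suc i) \<ge> 1/2 \<or> m i" and i: "i < n"
      by auto
    show ?case
    proof (cases "z (Suc (Suc i)) < 1/2 \<and> z (Suc i) < 1")
      case True
      let ?D = "pospow p (z i - z (Suc i))" and ?D' = "pospow p (z (Suc i) - z (Suc (Suc i)))"
      have st: "?D' \<ge> ?D + \<bar>z (Suc i)\<bar> ^ p - \<epsilon>"
        using step[OF i] True by auto
      have "m (Suc i)"
      proof (cases "z (Suc i) \<ge> 1/2")
        case z: True
        have "(1/2) ^ p \<le> \<bar>z (Suc i)\<bar> ^ p"
          using z by (intro power_mono) auto
        then have "?D' \<ge> (1/4) ^ p"
          using st pospow_nonneg[of p "z i - z (Suc i)"] q2 q4 e16 \<epsilon>0 by linarith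
        then show ?thesis
          using weak True by blast
      next
        case z: False
        then have mi: "m i"
          using IH by auto
        have pos: "0 \<le> \<bar>z (Suc i)\<bar> ^ p"
          by simp
        show ?thesis
        proof (cases "z (Suc i) < - 1/8")
          case low: True
          have "(1/8) ^ p \<le> \<bar>z (Suc i)\<bar> ^ p"
            using low by (intro power_mono) auto
          then have DD: "?D' \<ge> ?D"
            using st e16 \<epsilon>0 by linarith
          then have "?D' \<ge> (1/8) ^ p"
            using strong[OF mi] q4 e16 \<epsilon>0 by linarith
          then have "z (Suc (Suc i)) \<le> z (Suc i)"
            using p pospow_ge_iff[of p "1/8" "z (Suc i) - z (Suc (Suc i))"] by auto
          then have "8 * \<epsilon> * (1/2 - max (z (Suc i)) (- 1/4)) \<le> 8 * \<epsilon> * (1/2 - max (z (Suc (Suc i))) (- 1/4))"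
            using \<epsilon>0 by (intro mult_left_mono) auto
          then show ?thesis
            using mi DD True by (auto simp: m_def)
        next
          case high: False
          have "?D' \<ge> (1/8) ^ p"
            using st pos strong[OF mi] q4 e16 \<epsilon>0 by linarith
          then have "1/8 \<le> z (Suc i) - z (Suc (Suc i))"
            using p pospow_ge_iff[of p "1/8" "z (Suc i) - z (Suc (Suc i))"] by auto
          then have "8 * \<epsilon> * (1/2 - max (z (Suc i)) (- 1/4) + 1/8) \<le> 8 * \<epsilon> * (1/2 - max (z (Suc (Suc i))) (- 1/4))"
            using high \<epsilon>0 by (intro mult_left_mono) auto
          moreover have "8 * \<epsilon> * (1/2 - max (z (Suc i)) (- 1/4) + 1/8) = 8 * \<epsilon> * (1/2 - max (z (Suc i)) (- 1/4)) + \<epsilon>"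
            by (simp add: algebra_simps)
          ultimately have "?D' \<ge> (1/4) ^ p - 8 * \<epsilon> * (1/2 - max (z (Suc (Suc i))) (- 1/4))"
            using mi st pos unfolding m_def by linarith
          then show ?thesis
            using True by (auto simp: m_def)
        qed
      qed
      then show ?thesis ..
    next
      case False
      then show ?thesis
        using jump[of "Suc i"] by linarith
    qed
  qed
  have "m n"
    using main[of n] zn by auto
  from strong[OF this] show ?thesis
    using q4 e16 \<epsilon>0 by linarith
qed

text \<open>\<open>G\<close> is, up to a constant factor, the gradient of a block. By homogeneity
  \<open>s = 1\<close> may be assumed. If all entries were small, the first \<open>n\<close> would
  give the recurrence of \<open>chain_momentum\<close>, while the last one, which has no outgoing
  momentum, would bound the momentum arriving at height 0 by less than
  \<open>\<epsilon>\<close>.\<close>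

lemma chain_gradient:
  fixes y :: "nat \<Rightarrow> real"
  assumes p: "p \<ge> 1" and s: "s > 0" and yn: "y n = 0"
  defines "d \<equiv> \<lambda>i. (case i of 0 \<Rightarrow> s | Suc i' \<Rightarrow> y i') - y i"
  defines "G \<equiv> \<lambda>i. (if i < n then pospow p (d (Suc i)) else 0) - pospow p (d i)
    - pospow p (- y i) - pospow p (y i) + 2 * pospow p (2 * y i - 2 * s)"
  shows "\<exists>i\<le>n. \<bar>G i\<bar> \<ge> s ^ p * ((1/8) ^ p / 16)"
proof (rule ccontr)
  \<comment> \<open>The index is shifted by one so that \<open>z 0 = 1\<close> is the fixed start of
    the chain and \<open>z (Suc i)\<close> the rescaled \<open>y i\<close>.\<close>
  define z where "z i = (case i of 0 \<Rightarrow> s | Suc i' \<Rightarrow> y i') / s" for i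
  define \<epsilon> :: real where "\<epsilon> = (1/8) ^ p / 16"
  have yz: "y i = s * z (Suc i)" for i
    using s by (simp add: z_def)
  have dz: "d i = s * (z i - z (Suc i))" for i
    using s by (simp add: d_def z_def field_simps)
  have G_eq: "G i = s ^ p * ((if i < n then pospow p (z (Suc i) - z (Suc (Suc i))) else 0)
      - pospow p (z i - z (Suc i)) - pospow p (- z (Suc i)) - pospow p (z (Suc i))
      + 2 * pospow p (2 * z (Suc i) - 2))" (is "_ = _ * ?g i") for i
  proof -
    have "y i = s * z (Suc i)" "- y i = s * - z (Suc i)" "2 * y i - 2 * s = s * (2 * z (Suc i) - 2)"
      by (simp_all add: yz algebra_simps)
    then have "pospow p (y i) = s ^ p * pospow p (z (Suc i))"
      "pospow p (- y i) = s ^ p * pospow p (- z (Suc i))"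
      "pospow p (2 * y i - 2 * s) = s ^ p * pospow p (2 * z (Suc i) - 2)"
      using s pospow_scale less_imp_le by metis+
    moreover have "pospow p (d j) = s ^ p * pospow p (z j - z (Suc j))" for j
      using s dz pospow_scale less_imp_le by metis
    ultimately show ?thesis
      unfolding G_def by (simp add: right_diff_distrib distrib_left)
  qed
  assume contra: "\<not> ?thesis"
  have small: "\<bar>?g i\<bar> < \<epsilon>" if "i \<le> n" for i
  proof -
    have "\<bar>G i\<bar> < s ^ p * \<epsilon>"
      using contra that unfolding \<epsilon>_def by (meson not_le)
    then have "s ^ p * \<bar>?g i\<bar> < s ^ p * \<epsilon>"
      using s unfolding G_eq abs_mult by simp
    then show ?thesis
      using s by (simp only: mult_less_cancel_left_pos zero_less_power)
  qed
  have abs_eq: "pospow p (- t) + pospow p t = \<bar>t\<bar> ^ p" for t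
    using p by (cases "t \<le> 0") (auto simp: pospow_def max_def)
  have zn: "z (Suc n) = 0"
    using yn by (simp add: z_def)
  have "pospow p (z n - z (Suc n)) \<ge> (1/8) ^ p"
  proof (rule chain_momentum[where \<epsilon> = \<epsilon>])
    show "z 0 = 1"
      using s by (simp add: z_def)
    \<comment> \<open>Up to height 1 the term \<open>pospow p (2 * z (Suc i) - 2)\<close> vanishes,
      and by \<open>abs_eq\<close> the two remaining forces add up to
      \<open>\<bar>z (Suc i)\<bar> ^ p\<close>.\<close>
    show "pospow p (z (Suc i) - z (Suc (Suc i))) \<ge> pospow p (z i - z (Suc i)) + \<bar>z (Suc i)\<bar> ^ p - \<epsilon>"
      if "i < n" "z (Suc i) \<le> 1" for i
      using small[of i] that p pospow_nonpos[of "2 * z (Suc i) - 2" p] abs_eq[of "z (Suc i)"] by auto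
  qed (use p zn in \<open>auto simp: \<epsilon>_def\<close>)
  moreover have "pospow p (z n - z (Suc n)) < \<epsilon>"
    using small[of n] p pospow_nonpos[of 0 p] pospow_nonpos[of "-2" p] by (auto simp: zn)
  moreover have "\<epsilon> \<le> (1/8) ^ p"
    by (simp add: \<epsilon>_def)
  ultimately show False
    by linarith
qed

section \<open>Sums of ridge functions\<close>

text \<open>The Cauchy-Schwarz inequality on finite subsets bounds all partial sums of absolute
  values, which yields convergence and size at once. Every series of the construction is dominated
  by such a product of two square-summable families.\<close>

lemma infsum_product_bound:
  fixes a b g :: "'i \<Rightarrow> real"
  assumes g: "\<And>j. j \<in> A \<Longrightarrow> \<bar>g j\<bar> \<le> K * (\<bar>a j\<bar> * \<bar>b j\<bar>)" and K: "0 \<le> K"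
    and a: "\<And>J. finite J \<Longrightarrow> J \<subseteq> A \<Longrightarrow> (\<Sum>j\<in>J. (a j)\<^sup>2) \<le> X\<^sup>2" and X: "0 \<le> X"
    and b: "\<And>J. finite J \<Longrightarrow> J \<subseteq> A \<Longrightarrow> (\<Sum>j\<in>J. (b j)\<^sup>2) \<le> Y\<^sup>2" and Y: "0 \<le> Y"
  shows "g summable_on A" and "\<bar>infsum g A\<bar> \<le> K * (X * Y)"
proof -
  have fin: "(\<Sum>j\<in>J. norm (g j)) \<le> K * (X * Y)" if J: "finite J" "J \<subseteq> A" for J
  proof -
    have "(\<Sum>j\<in>J. \<bar>a j\<bar> * \<bar>b j\<bar>)\<^sup>2 \<le> (\<Sum>j\<in>J. \<bar>a j\<bar>\<^sup>2) * (\<Sum>j\<in>J. \<bar>b j\<bar>\<^sup>2)"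
      by (rule Cauchy_Schwarz_ineq_sum)
    also have "\<dots> \<le> X\<^sup>2 * Y\<^sup>2"
      using a[OF J] b[OF J] by (intro mult_mono) (auto intro: sum_nonneg)
    finally have "(\<Sum>j\<in>J. \<bar>a j\<bar> * \<bar>b j\<bar>)\<^sup>2 \<le> (X * Y)\<^sup>2"
      by (simp only: power_mult_distrib)
    then have "(\<Sum>j\<in>J. \<bar>a j\<bar> * \<bar>b j\<bar>) \<le> X * Y"
      by (rule power2_le_imp_le) (use X Y in simp)
    then have "K * (\<Sum>j\<in>J. \<bar>a j\<bar> * \<bar>b j\<bar>) \<le> K * (X * Y)"
      using K by (rule mult_left_mono)
    moreover have "(\<Sum>j\<in>J. norm (g j)) \<le> (\<Sum>j\<in>J. K * (\<bar>a j\<bar> * \<bar>b j\<bar>))"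
      using g J by (intro sum_mono) auto
    ultimately show ?thesis
      by (simp add: sum_distrib_left)
  qed
  have abs: "(\<lambda>j. norm (g j)) summable_on A"
    by (rule nonneg_bounded_partial_sums_imp_summable_on[where C = "K * (X * Y)"])
      (use fin in \<open>auto intro!: eventually_finite_subsets_at_top_weakI\<close>)
  then show "g summable_on A"
    by (rule abs_summable_summable)
  have "norm (infsum g A) \<le> (\<Sum>\<^sub>\<infinity>j\<in>A. norm (g j))"
    using abs by (rule norm_infsum_bound)
  also have "\<dots> \<le> K * (X * Y)"
    using abs fin by (rule infsum_le_finite_sums)
  finally show "\<bar>infsum g A\<bar> \<le> K * (X * Y)"
    by simp
qed

lemma
  fixes f g :: "'i \<Rightarrow> real"
  assumes "f summable_on A" "g summable_on A"
  shows summable_on_diff_real: "(\<lambda>j. f j - g j) summable_on A"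
    and infsum_diff_real: "(\<Sum>\<^sub>\<infinity>j\<in>A. f j - g j) = infsum f A - infsum g A"
  using summable_on_add[of f A "\<lambda>j. - g j"] infsum_add[of f A "\<lambda>j. - g j"] assms
  by (simp_all add: summable_on_uminus infsum_uminus)

section \<open>Operator norms of multilinear forms\<close>

lemma prod_list_norm_nonneg [simp]: "0 \<le> prod_list (map norm vs)"
  by (induction vs) auto

lemma prod_list_norm_le_1: "\<forall>v\<in>set vs. norm v \<le> 1 \<Longrightarrow> prod_list (map norm vs) \<le> 1"
  by (induction vs) (auto intro: mult_le_one)

text \<open>The constant \<open>K\<close> bounds the set of values, and the list of zeros shows that
  it is not empty, so the real supremum in \<open>form_norm\<close> behaves as expected.\<close>

lemma form_norm_bounds:
  assumes T: "\<And>vs. length vs = r \<Longrightarrow> \<bar>T vs\<bar> \<le> K * prod_list (map norm vs)" and K: "0 \<le> K"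
  shows form_norm_le: "form_norm r T \<le> K"
    and form_norm_nonneg: "0 \<le> form_norm r T"
    and le_form_norm: "length vs = r \<Longrightarrow> \<forall>v\<in>set vs. norm v \<le> 1 \<Longrightarrow> \<bar>T vs\<bar> \<le> form_norm r T"
proof -
  define S where "S = {vs :: 'a list. length vs = r \<and> (\<forall>v\<in>set vs. norm v \<le> 1)}"
  have TK: "\<bar>T vs\<bar> \<le> K" if "vs \<in> S" for vs
    using T[of vs] mult_left_mono[OF prod_list_norm_le_1 K, of vs] that by (auto simp: S_def)
  have z: "replicate r 0 \<in> S"
    by (auto simp: S_def)
  show "form_norm r T \<le> K"
    unfolding form_norm_def S_def[symmetric] using z TK by (intro cSUP_least) auto
  have up: "\<bar>T vs\<bar> \<le> form_norm r T" if "vs \<in> S" for vs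
    unfolding form_norm_def S_def[symmetric] using that TK by (intro cSUP_upper bdd_aboveI2[of _ _ K]) auto
  show "0 \<le> form_norm r T"
    using up[OF z] by linarith
  show "\<bar>T vs\<bar> \<le> form_norm r T" if "length vs = r" "\<forall>v\<in>set vs. norm v \<le> 1"
    using up that by (simp add: S_def)
qed

lemma form_norm_cong:
  assumes "\<And>vs. length vs = r \<Longrightarrow> T vs = T' vs"
  shows "form_norm r T = form_norm r T'"
  unfolding form_norm_def by (intro SUP_cong) (auto simp: assms)

text \<open>The summands are \<open>c j * pospow (p + 1) (\<alpha> j + x \<bullet> b j)\<close>. The
  bound \<open>coeff\<close> absorbs the factorial from differentiating and the powers of
  \<open>B\<close> from the directions, so that the Lipschitz constant of the last derivative is 1;
  \<open>offset\<close> controls the value and the derivatives at the origin.\<close>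

locale ridge_sum =
  fixes A :: "'i set" and c \<alpha> :: "'i \<Rightarrow> real" and b :: "'i \<Rightarrow> 'a::real_inner"
    and p :: nat and B :: real
  assumes p: "p \<ge> 1" and B: "B \<ge> 1"
    and coeff: "\<And>j. j \<in> A \<Longrightarrow> \<bar>c j\<bar> * (fact (p + 1) * B ^ (p + 1)) \<le> 1"
    and offset: "\<And>J. finite J \<Longrightarrow> J \<subseteq> A \<Longrightarrow> (\<Sum>j\<in>J. (max (\<alpha> j) 0)\<^sup>2) \<le> 1"
    and bessel: "\<And>J x. finite J \<Longrightarrow> J \<subseteq> A \<Longrightarrow> (\<Sum>j\<in>J. (x \<bullet> b j)\<^sup>2) \<le> (B * norm x)\<^sup>2"
begin

text \<open>The falling factorial arises from differentiating a \<open>(p + 1)\<close>-st power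
  \<open>r\<close> times.\<close>

definition weight :: "nat \<Rightarrow> 'i \<Rightarrow> real" where
  "weight r j = c j * (fact (p + 1) / fact (p + 1 - r))"

definition summand :: "nat \<Rightarrow> 'a \<Rightarrow> 'a list \<Rightarrow> 'i \<Rightarrow> real" where
  "summand r x vs j =
     weight r j * pospow (p + 1 - r) (\<alpha> j + x \<bullet> b j) * prod_list (map (\<lambda>v. v \<bullet> b j) vs)"

text \<open>The derivative obtained by formal termwise differentiation; \<open>nabla_ridge\<close>
  identifies it with the true one for \<open>r \<le> p\<close>.\<close>

definition form :: "nat \<Rightarrow> 'a \<Rightarrow> 'a list \<Rightarrow> real" where
  "form r x vs = infsum (summand r x vs) A"

definition ridge :: "'a \<Rightarrow> real" where
  "ridge x = form 0 x []"

section \<open>Size of the formal derivatives\<close>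

lemma weight_bound:
  assumes "j \<in> A"
  shows "\<bar>weight r j\<bar> \<le> 1 / B ^ (p + 1)"
proof -
  have "fact (p + 1) / fact (p + 1 - r) \<le> (fact (p + 1) :: real)"
    by (simp add: divide_le_eq mult_le_cancel_left1 del: fact_Suc)
  then have "\<bar>weight r j\<bar> \<le> \<bar>c j\<bar> * fact (p + 1)"
    unfolding weight_def abs_mult by (intro mult_left_mono) auto
  moreover have "\<bar>c j\<bar> * fact (p + 1) * B ^ (p + 1) \<le> 1"
    using coeff[OF assms] by (simp add: mult.assoc)
  ultimately show ?thesis
    using B by (smt (verit) pos_le_divide_eq zero_less_power)
qed

lemma weight_bound_1: "j \<in> A \<Longrightarrow> \<bar>weight r j\<bar> \<le> 1"
  using weight_bound[of j r] B by (smt (verit) divide_le_eq_1 one_le_power)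

lemma weight_Suc:
  assumes "r \<le> p"
  shows "weight (Suc r) j = weight r j * real (p + 1 - r)"
proof -
  have "p + 1 - r = Suc (p - r)" "p + 1 - Suc r = p - r"
    using assms by auto
  then show ?thesis
    by (simp add: weight_def del: of_nat_Suc)
qed

lemma inner_bound: "j \<in> A \<Longrightarrow> \<bar>v \<bullet> b j\<bar> \<le> B * norm v"
  using bessel[of "{j}" v] B by (simp add: abs_le_square_iff[symmetric])

lemma prod_list_inner_bound:
  "j \<in> A \<Longrightarrow> \<bar>prod_list (map (\<lambda>v. v \<bullet> b j) vs)\<bar> \<le> B ^ length vs * prod_list (map norm vs)"
proof (induction vs)
  case (Cons v vs)
  have "\<bar>v \<bullet> b j\<bar> * \<bar>prod_list (map (\<lambda>v. v \<bullet> b j) vs)\<bar>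
      \<le> (B * norm v) * (B ^ length vs * prod_list (map norm vs))"
    using Cons B inner_bound[of j v] by (intro mult_mono) auto
  then show ?case
    by (simp add: abs_mult mult_ac)
qed auto

text \<open>A square-summable family dominating the positive parts of the arguments. Negative
  offsets only shrink a positive part, so they enter as 0.\<close>

definition arg_bound :: "'a \<Rightarrow> 'i \<Rightarrow> real" where
  "arg_bound x j = max (\<alpha> j) 0 + \<bar>x \<bullet> b j\<bar>"

lemma arg_le: "max (\<alpha> j + x \<bullet> b j) 0 \<le> arg_bound x j"
  by (auto simp: arg_bound_def)

lemma arg_bound_nonneg: "0 \<le> arg_bound x j"
  by (auto simp: arg_bound_def)

lemma arg_bound_le:
  assumes "j \<in> A"
  shows "arg_bound x j \<le> 1 + B * norm x"
proof -
  have "(max (\<alpha> j) 0)\<^sup>2 \<le> 1\<^sup>2"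
    using offset[of "{j}"] assms by simp
  then have "max (\<alpha> j) 0 \<le> 1"
    by (rule power2_le_imp_le) simp
  then show ?thesis
    using inner_bound[OF assms, of x] by (simp add: arg_bound_def)
qed

lemma arg_bound_square_sum:
  assumes "finite J" "J \<subseteq> A"
  shows "(\<Sum>j\<in>J. (arg_bound x j)\<^sup>2) \<le> (2 * (1 + B * norm x))\<^sup>2"
proof -
  have *: "(u + \<bar>v\<bar>)\<^sup>2 \<le> 2 * u\<^sup>2 + 2 * v\<^sup>2" for u v :: real
    using zero_le_power2[of "u - \<bar>v\<bar>"] by (simp add: power2_eq_square algebra_simps)
  have "(\<Sum>j\<in>J. (arg_bound x j)\<^sup>2) \<le> (\<Sum>j\<in>J. 2 * (max (\<alpha> j) 0)\<^sup>2 + 2 * (x \<bullet> b j)\<^sup>2)"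
    unfolding arg_bound_def by (intro sum_mono *)
  also have "\<dots> = 2 * (\<Sum>j\<in>J. (max (\<alpha> j) 0)\<^sup>2) + 2 * (\<Sum>j\<in>J. (x \<bullet> b j)\<^sup>2)"
    by (simp add: sum.distrib sum_distrib_left)
  also have "\<dots> \<le> 2 * 1 + 2 * (B * norm x)\<^sup>2"
    using offset[OF assms] bessel[OF assms, of x] by linarith
  also have "\<dots> \<le> (2 * (1 + B * norm x))\<^sup>2"
    using B by (simp add: power2_eq_square algebra_simps)
  finally show ?thesis .
qed

text \<open>Two of the \<open>p + 1\<close> factors are summed as squares and the other
  \<open>p - 1\<close> are bounded by \<open>R\<close>. The family \<open>y\<close> is kept general:
  \<open>arg_bound\<close> serves at arbitrary points, and the positive offsets alone give the
  sharper bound at the origin.\<close>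

lemma form_0_bound:
  assumes y: "\<And>j. j \<in> A \<Longrightarrow> max (\<alpha> j + x \<bullet> b j) 0 \<le> y j" "\<And>j. j \<in> A \<Longrightarrow> y j \<le> R"
    and R: "0 \<le> R" and X: "0 \<le> X"
    and sq: "\<And>J. finite J \<Longrightarrow> J \<subseteq> A \<Longrightarrow> (\<Sum>j\<in>J. (y j)\<^sup>2) \<le> X\<^sup>2"
  shows "summand 0 x [] summable_on A" "\<bar>form 0 x []\<bar> \<le> R ^ (p - 1) * (X * X)"
proof -
  have "\<bar>summand 0 x [] j\<bar> \<le> R ^ (p - 1) * (\<bar>y j\<bar> * \<bar>y j\<bar>)" if j: "j \<in> A" for j
  proof -
    let ?t = "\<alpha> j + x \<bullet> b j"
    have y0: "0 \<le> y j"
      using y(1)[OF j] by linarith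
    have "pospow (p + 1) ?t = max ?t 0 * pospow p ?t"
      by (simp add: pospow_def)
    also have "\<dots> \<le> y j * (y j * R ^ (p - 1))"
      using y[OF j] p y0 by (intro mult_mono pospow_le) auto
    finally have "\<bar>weight 0 j\<bar> * pospow (p + 1) ?t \<le> 1 * (y j * (y j * R ^ (p - 1)))"
      by (rule mult_mono[OF weight_bound_1[OF j]]) auto
    then show ?thesis
      using y0 by (simp add: summand_def abs_mult mult_ac)
  qed
  from infsum_product_bound[of A "summand 0 x []", OF this _ sq X sq X]
  show "summand 0 x [] summable_on A" "\<bar>form 0 x []\<bar> \<le> R ^ (p - 1) * (X * X)"
    using R by (simp_all add: form_def)
qed

text \<open>The Cauchy-Schwarz inequality pairs one factor \<open>y j\<close> with the first
  direction, whose inner products are square-summable by \<open>bessel\<close>. The directions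
  produce \<open>B ^ r\<close> in total, which the weight cancels.\<close>

lemma form_Suc_bound:
  assumes y: "\<And>j. j \<in> A \<Longrightarrow> max (\<alpha> j + x \<bullet> b j) 0 \<le> y j" "\<And>j. j \<in> A \<Longrightarrow> y j \<le> R"
    and R: "0 \<le> R" and X: "0 \<le> X"
    and sq: "\<And>J. finite J \<Longrightarrow> J \<subseteq> A \<Longrightarrow> (\<Sum>j\<in>J. (y j)\<^sup>2) \<le> X\<^sup>2"
    and len: "length vs = r" "1 \<le> r" "r \<le> p"
  shows "summand r x vs summable_on A"
    and "\<bar>form r x vs\<bar> \<le> R ^ (p - r) * X * prod_list (map norm vs)"
proof -
  obtain v us where vs: "vs = v # us"
    using len by (cases vs) auto
  let ?P = "prod_list (map norm us)"
  define K where "K = 1 / B ^ (p + 1) * R ^ (p - r) * (B ^ length us * ?P)"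
  have K: "0 \<le> K"
    using R B by (simp add: K_def)
  have "\<bar>summand r x vs j\<bar> \<le> K * (\<bar>y j\<bar> * \<bar>v \<bullet> b j\<bar>)" if j: "j \<in> A" for j
  proof -
    let ?t = "\<alpha> j + x \<bullet> b j"
    have y0: "0 \<le> y j"
      using y(1)[OF j] by linarith
    have "pospow (p + 1 - r) ?t \<le> y j * R ^ (p - r)"
      using pospow_le[OF y(1)[OF j] y(2)[OF j], of "p + 1 - r"] len by auto
    then have "\<bar>weight r j\<bar> * pospow (p + 1 - r) ?t * (\<bar>v \<bullet> b j\<bar> * \<bar>prod_list (map (\<lambda>v. v \<bullet> b j) us)\<bar>)
        \<le> 1 / B ^ (p + 1) * (y j * R ^ (p - r)) * (\<bar>v \<bullet> b j\<bar> * (B ^ length us * ?P))"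
      using B y0 R
      by (intro mult_mono[OF mult_mono[OF weight_bound[OF j]] mult_left_mono[OF prod_list_inner_bound[OF j]]]) auto
    then show ?thesis
      using y0 by (simp add: summand_def vs abs_mult K_def mult_ac)
  qed
  note * = infsum_product_bound[of A "summand r x vs", OF this K sq X bessel[of _ v]]
  show "summand r x vs summable_on A"
    using B by (intro *(1)) auto
  have "\<bar>form r x vs\<bar> \<le> K * (X * (B * norm v))"
    unfolding form_def using B by (intro *(2)) auto
  also have "\<dots> = B ^ r / B ^ (p + 1) * (R ^ (p - r) * X * prod_list (map norm vs))"
    using len by (auto simp: K_def vs mult_ac)
  also have "\<dots> \<le> 1 * (R ^ (p - r) * X * prod_list (map norm vs))"
  proof (intro mult_right_mono)
    show "B ^ r / B ^ (p + 1) \<le> 1"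
      using B len by (simp add: power_increasing divide_le_eq_1 del: power_Suc)
  qed (use R X in auto)
  finally show "\<bar>form r x vs\<bar> \<le> R ^ (p - r) * X * prod_list (map norm vs)"
    by simp
qed

section \<open>Differentiability and Lipschitz continuity of the derivatives\<close>

lemma summand_summable:
  assumes "r \<le> p" "length vs = r"
  shows "summand r x vs summable_on A"
proof (cases "r = 0")
  case True
  then show ?thesis
    using form_0_bound(1)[OF arg_le arg_bound_le _ _ arg_bound_square_sum] B assms by auto
next
  case False
  then show ?thesis
    using form_Suc_bound(1)[OF arg_le arg_bound_le _ _ arg_bound_square_sum assms(2) _ assms(1)] B by auto
qed

lemma form_linear:
  assumes "r \<le> p" "length us + length ws + 1 = r"
  shows "linear (\<lambda>v. form r x (us @ v # ws))"
proof -
  have s: "summand r x (us @ v # ws) summable_on A" for v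
    using assms by (intro summand_summable) auto
  show ?thesis
  proof (rule linearI)
    fix v w
    have "summand r x (us @ (v + w) # ws) = (\<lambda>j. summand r x (us @ v # ws) j + summand r x (us @ w # ws) j)"
      by (auto simp: summand_def inner_add_left algebra_simps)
    then show "form r x (us @ (v + w) # ws) = form r x (us @ v # ws) + form r x (us @ w # ws)"
      unfolding form_def by (simp add: infsum_add[OF s s])
  next
    fix k v
    have "summand r x (us @ (k *\<^sub>R v) # ws) = (\<lambda>j. k * summand r x (us @ v # ws) j)"
      by (auto simp: summand_def algebra_simps)
    then show "form r x (us @ (k *\<^sub>R v) # ws) = k *\<^sub>R form r x (us @ v # ws)"
      unfolding form_def using s by (simp add: infsum_cmult_right)
  qed
qed

lemma form_bounded:
  assumes "r \<le> p"
  obtains K where "0 \<le> K" "\<And>vs. length vs = r \<Longrightarrow> \<bar>form r x vs\<bar> \<le> K * prod_list (map norm vs)"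
proof (cases "r = 0")
  case True
  then show ?thesis
    using that[of "\<bar>form r x []\<bar>"] by auto
next
  case False
  let ?R = "1 + B * norm x"
  show ?thesis
  proof (rule that)
    show "0 \<le> ?R ^ (p - r) * (2 * ?R)"
      using B by auto
    show "\<bar>form r x vs\<bar> \<le> ?R ^ (p - r) * (2 * ?R) * prod_list (map norm vs)" if "length vs = r" for vs
      using form_Suc_bound(2)[OF arg_le arg_bound_le _ _ arg_bound_square_sum that _ assms] False B by auto
  qed
qed

lemma bounded_form_form:
  assumes "r \<le> p"
  shows "bounded_form r (form r x)"
  unfolding bounded_form_def using form_linear[OF assms] form_bounded[OF assms] by metis

text \<open>The scalar Taylor estimate is applied to each summand, and the squared increments are
  summed by \<open>bessel\<close>. The estimate is uniform in \<open>vs\<close>, hence gives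
  differentiability in the operator norm; confining \<open>y\<close> to a unit ball makes
  \<open>R\<close> uniform.\<close>

lemma form_taylor:
  assumes r: "r < p"
  obtains K where "0 \<le> K" "\<And>y vs. length vs = r \<Longrightarrow> norm (y - x) \<le> 1 \<Longrightarrow>
    \<bar>form r y vs - form r x vs - form (Suc r) x ((y - x) # vs)\<bar>
      \<le> K * (norm (y - x))\<^sup>2 * prod_list (map norm vs)"
proof -
  define n where "n = p - 1 - r"
  have n: "p + 1 - r = n + 2" "p + 1 - Suc r = n + 1"
    using r by (auto simp: n_def)
  define R where "R = 1 + B * (norm x + 1)"
  have R: "0 \<le> R"
    using B by (auto simp: R_def)
  define K where "K = real ((n + 2)\<^sup>2) * R ^ n * B ^ r * B\<^sup>2"
  have K: "0 \<le> K"
    using B R by (simp add: K_def)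
  have "\<bar>form r y vs - form r x vs - form (Suc r) x ((y - x) # vs)\<bar>
      \<le> K * (norm (y - x))\<^sup>2 * prod_list (map norm vs)"
    if vs: "length vs = r" and yx: "norm (y - x) \<le> 1" for y vs
  proof -
    let ?P = "prod_list (map norm vs)" and ?d = "\<lambda>j. (y - x) \<bullet> b j"
    define g where "g j = summand r y vs j - summand r x vs j - summand (Suc r) x ((y - x) # vs) j" for j
    define L where "L = real ((n + 2)\<^sup>2) * R ^ n * (B ^ r * ?P)"
    have L: "0 \<le> L"
      using R B by (simp add: L_def)
    have g: "\<bar>g j\<bar> \<le> L * (\<bar>?d j\<bar> * \<bar>?d j\<bar>)" if j: "j \<in> A" for j
    proof -
      define s t where "s = \<alpha> j + y \<bullet> b j" and "t = \<alpha> j + x \<bullet> b j"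
      have ny: "norm y \<le> norm x + 1"
        using yx norm_triangle_ineq2[of y x] by linarith
      then have "1 + B * norm y \<le> R" "1 + B * norm x \<le> R"
        using B unfolding R_def by (auto intro!: mult_left_mono)
      then have st: "max s 0 \<le> R" "max t 0 \<le> R"
        using arg_le[of j y] arg_bound_le[OF j, of y] arg_le[of j x] arg_bound_le[OF j, of x]
        unfolding s_def t_def by linarith+
      have d: "?d j = s - t"
        by (simp add: s_def t_def inner_diff_left)
      have w: "weight (Suc r) j = weight r j * real (n + 2)"
        using weight_Suc[of r j] r unfolding n by simp
      have "g j = weight r j * (pospow (n + 2) s - pospow (n + 2) t - real (n + 2) * pospow (n + 1) t * (s - t))
          * prod_list (map (\<lambda>v. v \<bullet> b j) vs)"
        unfolding g_def summand_def s_def[symmetric] t_def[symmetric] n w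
        by (simp only: list.map prod_list.Cons d) (simp add: algebra_simps del: of_nat_add)
      also have "\<bar>\<dots>\<bar> \<le> 1 * (real ((n + 2)\<^sup>2) * R ^ n * (s - t)\<^sup>2) * (B ^ r * ?P)"
        unfolding abs_mult using weight_bound_1[OF j] pospow_taylor[OF st, of n]
          prod_list_inner_bound[OF j, of vs] R vs by (intro mult_mono) auto
      finally show ?thesis
        unfolding d L_def by (simp add: power2_eq_square mult_ac)
    qed
    have s: "summand r y vs summable_on A" "summand r x vs summable_on A"
      "summand (Suc r) x ((y - x) # vs) summable_on A"
      using r vs by (auto intro!: summand_summable)
    have "infsum g A = form r y vs - form r x vs - form (Suc r) x ((y - x) # vs)"
      unfolding g_def form_def
      by (simp only: infsum_diff_real[OF summable_on_diff_real[OF s(1,2)] s(3)] infsum_diff_real[OF s(1,2)])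
    moreover have "\<bar>infsum g A\<bar> \<le> L * ((B * norm (y - x)) * (B * norm (y - x)))"
      using B by (intro infsum_product_bound(2)[OF g L bessel _ bessel]) auto
    ultimately show ?thesis
      by (simp add: L_def K_def power2_eq_square mult_ac)
  qed
  with K show ?thesis
    by (rule that)
qed

text \<open>For a fixed list this is the derivative of a real-valued map, which is what the
  recursion of \<open>nabla\<close> differentiates.\<close>

lemma form_has_derivative:
  assumes r: "r < p" and vs: "length vs = r"
  shows "((\<lambda>y. form r y vs) has_derivative (\<lambda>d. form (Suc r) x (d # vs))) (at x)"
proof -
  obtain K where K: "0 \<le> K" "\<And>y. norm (y - x) \<le> 1 \<Longrightarrow>
      \<bar>form r y vs - form r x vs - form (Suc r) x ((y - x) # vs)\<bar>
        \<le> K * (norm (y - x))\<^sup>2 * prod_list (map norm vs)"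
    using form_taylor[OF r] vs by metis
  define L where "L = K * prod_list (map norm vs) + 1"
  have L: "0 < L"
    using K(1) by (simp add: L_def add_nonneg_pos)
  obtain M where M: "\<And>vs. length vs = Suc r \<Longrightarrow> \<bar>form (Suc r) x vs\<bar> \<le> M * prod_list (map norm vs)"
    using form_bounded[of "Suc r" x] r by auto
  have lin: "linear (\<lambda>d. form (Suc r) x (d # vs))"
    using form_linear[of "Suc r" "[]" vs x] r vs by simp
  have bl: "bounded_linear (\<lambda>d. form (Suc r) x (d # vs))"
    unfolding bounded_linear_def bounded_linear_axioms_def
    using lin M[of "_ # vs"] vs by (auto intro!: exI[of _ "M * prod_list (map norm vs)"] simp: mult_ac)
  have "\<exists>\<delta>>0. \<forall>y. norm (y - x) < \<delta> \<longrightarrow>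
      norm (form r y vs - form r x vs - form (Suc r) x ((y - x) # vs)) \<le> e * norm (y - x)" if "e > 0" for e
  proof (intro exI[of _ "min 1 (e / L)"] conjI allI impI)
    show "0 < min 1 (e / L)"
      using that L by simp
    fix y assume y: "norm (y - x) < min 1 (e / L)"
    then have "\<bar>form r y vs - form r x vs - form (Suc r) x ((y - x) # vs)\<bar>
        \<le> K * (norm (y - x))\<^sup>2 * prod_list (map norm vs)"
      by (intro K(2)) auto
    also have "\<dots> = (K * prod_list (map norm vs) * norm (y - x)) * norm (y - x)"
      by (simp add: power2_eq_square mult_ac)
    also have "\<dots> \<le> (L * norm (y - x)) * norm (y - x)"
      by (intro mult_right_mono) (auto simp: L_def)
    also have "\<dots> \<le> e * norm (y - x)"
      using y L by (intro mult_right_mono) (auto simp: field_simps)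
    finally show "norm (form r y vs - form r x vs - form (Suc r) x ((y - x) # vs)) \<le> e * norm (y - x)"
      by simp
  qed
  then show ?thesis
    unfolding has_derivative_at_alt using bl by blast
qed

lemma nabla_ridge:
  "r \<le> p \<Longrightarrow> length vs = r \<Longrightarrow> nabla r ridge x vs = form r x vs"
proof (induction r arbitrary: x vs)
  case 0
  then show ?case
    by (simp add: ridge_def)
next
  case (Suc r)
  obtain v us where vs: "vs = v # us"
    using Suc.prems by (cases vs) auto
  have "(\<lambda>y. nabla r ridge y us) = (\<lambda>y. form r y us)"
    using Suc vs by (intro ext) auto
  moreover have "((\<lambda>y. form r y us) has_derivative (\<lambda>d. form (Suc r) x (d # us))) (at x)"
    using Suc.prems vs by (intro form_has_derivative) auto
  ultimately show ?case
    by (simp add: vs frechet_derivative_at[symmetric])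
qed

text \<open>At order \<open>p\<close> only the first power of the positive part is left, which is
  1-Lipschitz. The increment, the first direction and the other directions produce exactly the
  \<open>B ^ (p + 1)\<close> that the weight cancels.\<close>

lemma form_lipschitz:
  assumes vs: "length vs = p"
  shows "\<bar>form p y vs - form p x vs\<bar> \<le> norm (y - x) * prod_list (map norm vs)"
proof -
  obtain v us where vs': "vs = v # us"
    using vs p by (cases vs) auto
  let ?P = "prod_list (map norm us)" and ?d = "\<lambda>j. (y - x) \<bullet> b j"
  define K where "K = 1 / B ^ (p + 1) * (B ^ length us * ?P)"
  have K: "0 \<le> K"
    using B by (simp add: K_def)
  have "\<bar>summand p y vs j - summand p x vs j\<bar> \<le> K * (\<bar>?d j\<bar> * \<bar>v \<bullet> b j\<bar>)" if j: "j \<in> A" for j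
  proof -
    let ?D = "pospow 1 (\<alpha> j + y \<bullet> b j) - pospow 1 (\<alpha> j + x \<bullet> b j)"
    have "\<bar>?D\<bar> \<le> \<bar>?d j\<bar>"
      using pospow_lipschitz_1[of "\<alpha> j + y \<bullet> b j" "\<alpha> j + x \<bullet> b j"] by (simp add: inner_diff_left)
    then have "\<bar>weight p j\<bar> * \<bar>?D\<bar> * (\<bar>v \<bullet> b j\<bar> * \<bar>prod_list (map (\<lambda>v. v \<bullet> b j) us)\<bar>)
        \<le> 1 / B ^ (p + 1) * \<bar>?d j\<bar> * (\<bar>v \<bullet> b j\<bar> * (B ^ length us * ?P))"
      using weight_bound[OF j] prod_list_inner_bound[OF j, of us] B by (intro mult_mono) auto
    moreover have "summand p y vs j - summand p x vs j
        = weight p j * ?D * (v \<bullet> b j * prod_list (map (\<lambda>v. v \<bullet> b j) us))"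
      by (simp add: summand_def vs' algebra_simps)
    ultimately show ?thesis
      by (simp add: abs_mult K_def mult_ac)
  qed
  note * = infsum_product_bound(2)[of A, OF this K bessel[of _ "y - x"] _ bessel[of _ v]]
  have "\<bar>form p y vs - form p x vs\<bar> = \<bar>\<Sum>\<^sub>\<infinity>j\<in>A. summand p y vs j - summand p x vs j\<bar>"
    unfolding form_def
    by (simp only: infsum_diff_real[OF summand_summable[OF order.refl vs] summand_summable[OF order.refl vs]])
  also have "\<dots> \<le> K * ((B * norm (y - x)) * (B * norm v))"
    using B by (intro *) auto
  also have "\<dots> = norm (y - x) * prod_list (map norm vs)"
    using B vs by (auto simp: K_def vs' field_simps)
  finally show ?thesis .
qed

lemma form_norm_nabla_lipschitz:
  "form_norm p (\<lambda>vs. nabla p ridge y vs - nabla p ridge x vs) \<le> norm (y - x)" (is ?le)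
  "0 \<le> form_norm p (\<lambda>vs. nabla p ridge y vs - nabla p ridge x vs)" (is ?ge)
proof -
  have eq: "form_norm p (\<lambda>vs. nabla p ridge y vs - nabla p ridge x vs)
      = form_norm p (\<lambda>vs. form p y vs - form p x vs)"
    by (intro form_norm_cong) (simp add: nabla_ridge)
  show ?le ?ge
    unfolding eq using form_lipschitz by (auto intro!: form_norm_le form_norm_nonneg[where K = "norm (y - x)"])
qed

lemma times_differentiable_ridge: "times_differentiable p ridge"
  unfolding times_differentiable_def
proof (intro conjI allI impI)
  fix r x assume r: "r \<le> p"
  then have "bounded_form r (form r x)"
    by (rule bounded_form_form)
  then show "bounded_form r (nabla r ridge x)"
    unfolding bounded_form_def using r by (simp add: nabla_ridge)
next
  fix r x assume r: "r < p"
  obtain K where K: "0 \<le> K" "\<And>y vs. length vs = r \<Longrightarrow> norm (y - x) \<le> 1 \<Longrightarrow>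
      \<bar>form r y vs - form r x vs - form (Suc r) x ((y - x) # vs)\<bar>
        \<le> K * (norm (y - x))\<^sup>2 * prod_list (map norm vs)"
    using form_taylor[OF r] by metis
  let ?T = "\<lambda>y vs. nabla r ridge y vs - nabla r ridge x vs - nabla (Suc r) ridge x ((y - x) # vs)"
  have eq: "form_norm r (?T y) = form_norm r (\<lambda>vs. form r y vs - form r x vs - form (Suc r) x ((y - x) # vs))" for y
    using r by (intro form_norm_cong) (simp add: nabla_ridge del: nabla.simps)
  have "0 \<le> form_norm r (?T y) \<and> form_norm r (?T y) \<le> K * (norm (y - x))\<^sup>2" if "norm (y - x) \<le> 1" for y
    unfolding eq using K that
    by (auto intro!: form_norm_le form_norm_nonneg[where K = "K * (norm (y - x))\<^sup>2"])
  then have "norm (form_norm r (?T y) / norm (y - x)) \<le> K * norm (y - x)" if "norm (y - x) \<le> 1" for y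
    using that K(1) by (cases "y = x") (auto simp: divide_le_eq power2_eq_square mult_ac)
  moreover have "\<forall>\<^sub>F y in at x. norm (y - x) \<le> 1"
    unfolding eventually_at by (intro exI[of _ 1]) (auto simp: dist_norm)
  ultimately have "\<forall>\<^sub>F y in at x. norm (form_norm r (?T y) / norm (y - x)) \<le> K * norm (y - x)"
    by (auto elim: eventually_mono)
  moreover have "((\<lambda>y. K * norm (y - x)) \<longlongrightarrow> 0) (at x)"
    by (rule tendsto_eq_intros refl | simp)+
  ultimately show "((\<lambda>y. form_norm r (?T y) / norm (y - x)) \<longlongrightarrow> 0) (at x)"
    by (rule Lim_null_comparison)
qed

lemma ridge_in_F_ncvx:
  assumes lower: "\<And>x. -1 \<le> ridge x"
  shows "ridge \<in> F_ncvx p"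
proof -
  have zero: "(\<Sum>j\<in>J. (max (\<alpha> j) 0)\<^sup>2) \<le> 1\<^sup>2" if "finite J" "J \<subseteq> A" for J
    using offset[OF that] by simp
  \<comment> \<open>At the origin the arguments are the offsets themselves, so the bounds apply with
    \<open>R = X = 1\<close>.\<close>
  have b0: "max (\<alpha> j + 0 \<bullet> b j) 0 \<le> max (\<alpha> j) 0" "j \<in> A \<Longrightarrow> max (\<alpha> j) 0 \<le> 1" for j
    using arg_bound_le[of j 0] by (auto simp: arg_bound_def)
  have "ridge 0 \<le> 1"
    using form_0_bound(2)[OF b0 _ _ zero] by (simp add: ridge_def)
  moreover have "form_norm r (nabla r ridge 0) \<le> 1" if r: "r \<in> {1..p}" for r
  proof (rule form_norm_le)
    show "\<bar>nabla r ridge 0 vs\<bar> \<le> 1 * prod_list (map norm vs)" if "length vs = r" for vs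
      using form_Suc_bound(2)[OF b0 _ _ zero that] r that by (simp add: nabla_ridge)
  qed simp
  moreover have "times_continuously_differentiable p ridge"
    unfolding times_continuously_differentiable_def
  proof (intro conjI allI times_differentiable_ridge)
    fix x :: 'a
    have "((\<lambda>y. norm (y - x)) \<longlongrightarrow> 0) (at x)"
      by (rule tendsto_eq_intros refl | simp)+
    then show "((\<lambda>y. form_norm p (\<lambda>vs. nabla p ridge y vs - nabla p ridge x vs)) \<longlongrightarrow> 0) (at x)"
      by (rule Lim_null_comparison[rotated])
        (simp add: form_norm_nabla_lipschitz)
  qed
  moreover have "-1 \<le> (INF x. ereal (ridge x))"
    using lower by (intro INF_greatest) (simp add: one_ereal_def)
  moreover have "(INF x. ereal (ridge x)) \<le> ereal (ridge 0)"
    by (rule INF_lower) simp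
  ultimately show ?thesis
    unfolding F_ncvx_def using form_norm_nabla_lipschitz(1) by auto
qed

lemma abs_partial_le_form_norm:
  assumes "norm v \<le> 1"
  shows "\<bar>form 1 x [v]\<bar> \<le> form_norm 1 (nabla 1 ridge x)"
proof -
  obtain K where K: "0 \<le> K" "\<And>vs. length vs = 1 \<Longrightarrow> \<bar>form 1 x vs\<bar> \<le> K * prod_list (map norm vs)"
    using form_bounded[of 1 x] p by auto
  have "\<bar>nabla 1 ridge x [v]\<bar> \<le> form_norm 1 (nabla 1 ridge x)"
  proof (rule le_form_norm)
    show "\<bar>nabla 1 ridge x vs\<bar> \<le> K * prod_list (map norm vs)" if "length vs = 1" for vs
      using K(2)[OF that] nabla_ridge[OF p that] by simp
  qed (use K assms in auto)
  then show ?thesis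
    using nabla_ridge[OF p, of "[v]" x] by simp
qed

end

section \<open>The hard function\<close>

text \<open>The squared distance from \<open>x\<close> to its projection \<open>y\<close> is
  nonnegative. The injection \<open>g\<close> allows sums over relabelled coordinates.\<close>

lemma bessel_inequality:
  fixes e :: "'j \<Rightarrow> 'a::real_inner"
  assumes orth: "\<And>i j. e i \<bullet> e j = (if i = j then 1 else 0)"
    and J: "finite J" "inj_on g J"
  shows "(\<Sum>j\<in>J. (x \<bullet> e (g j))\<^sup>2) \<le> (norm x)\<^sup>2"
proof -
  define K where "K = g ` J"
  define y where "y = (\<Sum>j\<in>K. (x \<bullet> e j) *\<^sub>R e j)"
  have K: "finite K"
    using J by (simp add: K_def)
  have xy: "x \<bullet> y = (\<Sum>j\<in>K. (x \<bullet> e j)\<^sup>2)"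
    by (simp add: y_def inner_sum_right power2_eq_square)
  have "y \<bullet> e i = x \<bullet> e i" if "i \<in> K" for i
    using that K by (simp add: y_def inner_sum_left orth if_distrib cong: if_cong)
  then have "y \<bullet> y = (\<Sum>j\<in>K. (x \<bullet> e j)\<^sup>2)"
    by (subst (2) y_def) (simp add: inner_sum_right power2_eq_square)
  then have "0 \<le> x \<bullet> x - (\<Sum>j\<in>K. (x \<bullet> e j)\<^sup>2)"
    using inner_ge_zero[of "x - y"] xy by (simp add: inner_diff inner_commute)
  then show ?thesis
    using J by (simp add: K_def sum.reindex power2_norm_eq_inner)
qed

text \<open>\<open>\<sigma>_sum\<close> serves the offsets of the ridge sum, and
  \<open>drop_sum\<close> keeps the total decrease over all blocks, each of length
  \<open>N k + 1\<close>, below 1.\<close>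

locale hard_function =
  fixes e :: "nat \<Rightarrow> 'a::real_inner" and p :: nat and N :: "nat \<Rightarrow> nat" and \<sigma> :: "nat \<Rightarrow> real"
  assumes orth: "\<And>i j. e i \<bullet> e j = (if i = j then 1 else 0)"
    and p: "p \<ge> 1"
    and \<sigma>_pos: "\<And>k. \<sigma> k > 0"
    and \<sigma>_sum: "\<And>K. finite K \<Longrightarrow> (\<Sum>k\<in>K. (\<sigma> k)\<^sup>2) \<le> 1"
    and drop_sum: "\<And>K. finite K \<Longrightarrow> (\<Sum>k\<in>K. (real (N k) + 1) * \<sigma> k ^ (p + 1)) \<le> 1"
begin

definition E :: "nat \<Rightarrow> nat \<Rightarrow> 'a" where
  "E k i = e (prod_encode (k, i))"

text \<open>The largest coefficient that \<open>coeff\<close> permits for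
  \<open>B = 4\<close>.\<close>

definition \<eta> :: real where
  "\<eta> = 1 / (fact (p + 1) * 4 ^ (p + 1))"

definition I :: "(nat \<times> nat) set" where
  "I = (SIGMA k:UNIV. {..N k})"

text \<open>
  Block \<open>k\<close> has the coordinates \<open>x\<^sub>0, \<dots>, x\<^sub>N\<close> along \<open>E k 0, \<dots>, E k (N k)\<close>; with \<open>x\<^sub>-\<^sub>1 = \<sigma> k\<close>, the four
  labels at \<open>(k, i)\<close> give the \<open>(p + 1)\<close>-st powers of the positive parts of \<open>x\<^sub>i\<^sub>-\<^sub>1 - x\<^sub>i\<close>, \<open>-x\<^sub>i\<close>, \<open>x\<^sub>i\<close>
  and \<open>2 * x\<^sub>i - 2 * \<sigma> k\<close>, the third with negative sign.
\<close>

definition A :: "((nat \<times> nat) \<times> nat) set" where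
  "A = (SIGMA ki:I. {..<4})"

fun c :: "(nat \<times> nat) \<times> nat \<Rightarrow> real" where
  "c ((k, i), q) = (if q = 2 then - \<eta> else \<eta>)"

fun \<alpha> :: "(nat \<times> nat) \<times> nat \<Rightarrow> real" where
  "\<alpha> ((k, i), q) = (if q = 0 then (case i of 0 \<Rightarrow> \<sigma> k | Suc _ \<Rightarrow> 0) else if q = 3 then - 2 * \<sigma> k else 0)"

fun b :: "(nat \<times> nat) \<times> nat \<Rightarrow> 'a" where
  "b ((k, i), q) = (if q = 0 then (case i of 0 \<Rightarrow> 0 | Suc i' \<Rightarrow> E k i') - E k i
     else if q = 1 then - E k i else if q = 2 then E k i else 2 *\<^sub>R E k i)"

lemma E_inner: "E k i \<bullet> E k' i' = (if k = k' \<and> i = i' then 1 else 0)"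
  by (simp add: E_def orth prod_encode_eq)

lemma norm_E: "norm (E k i) = 1"
  by (simp add: norm_eq_sqrt_inner E_inner)

lemma \<eta>_pos: "0 < \<eta>"
  by (simp add: \<eta>_def)

lemma sum_4: "(\<Sum>q<4. f q) = f 0 + f 1 + f 2 + f (3::nat)" for f :: "nat \<Rightarrow> real"
  by (simp add: eval_nat_numeral)

text \<open>With \<open>v\<close> the coordinate at a position and \<open>u\<close> its predecessor,
  taken as 0 at the start of a block, four labels contribute at most
  \<open>2 * u\<^sup>2 + 8 * v\<^sup>2\<close>. Both families satisfy Bessel's inequality, so the
  total is at most 10 times the squared norm, and 16 suffices.\<close>

lemma bessel_b:
  assumes J: "finite J" "J \<subseteq> A"
  shows "(\<Sum>j\<in>J. (x \<bullet> b j)\<^sup>2) \<le> (4 * norm x)\<^sup>2"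
proof -
  define J1 where "J1 = fst ` J"
  have J1: "finite J1"
    using J by (simp add: J1_def)
  define v where "v ki = x \<bullet> E (fst ki) (snd ki)" for ki
  define u where "u ki = (case snd ki of 0 \<Rightarrow> 0 | Suc i \<Rightarrow> x \<bullet> E (fst ki) i)" for ki
  have "(\<Sum>j\<in>J. (x \<bullet> b j)\<^sup>2) \<le> (\<Sum>j\<in>J1 \<times> {..<4}. (x \<bullet> b j)\<^sup>2)"
  proof (intro sum_mono2)
    show "J \<subseteq> J1 \<times> {..<4}"
      using J by (force simp: J1_def A_def)
  qed (use J1 in auto)
  also have "\<dots> = (\<Sum>ki\<in>J1. \<Sum>q<4. (x \<bullet> b (ki, q))\<^sup>2)"
    by (subst sum.cartesian_product) (simp add: case_prod_unfold)
  also have "\<dots> \<le> (\<Sum>ki\<in>J1. 2 * (u ki)\<^sup>2 + 8 * (v ki)\<^sup>2)"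
  proof (rule sum_mono)
    fix ki assume "ki \<in> J1"
    have *: "(s - t)\<^sup>2 + t\<^sup>2 + t\<^sup>2 + (2 * t)\<^sup>2 \<le> 2 * s\<^sup>2 + 8 * t\<^sup>2" for s t :: real
      using zero_le_power2[of "s + t"] by (simp add: power2_eq_square algebra_simps)
    obtain k i where ki: "ki = (k, i)"
      by fastforce
    have "(\<Sum>q<4. (x \<bullet> b (ki, q))\<^sup>2) = (u ki - v ki)\<^sup>2 + (v ki)\<^sup>2 + (v ki)\<^sup>2 + (2 * v ki)\<^sup>2"
      by (cases i) (simp_all add: sum_4 ki u_def v_def inner_diff_right)
    then show "(\<Sum>q<4. (x \<bullet> b (ki, q))\<^sup>2) \<le> 2 * (u ki)\<^sup>2 + 8 * (v ki)\<^sup>2"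
      using * by simp
  qed
  also have "\<dots> = 2 * (\<Sum>ki\<in>J1. (u ki)\<^sup>2) + 8 * (\<Sum>ki\<in>J1. (v ki)\<^sup>2)"
    by (simp add: sum.distrib sum_distrib_left)
  also have "(\<Sum>ki\<in>J1. (v ki)\<^sup>2) \<le> (norm x)\<^sup>2"
    unfolding v_def E_def using J1 by (intro bessel_inequality orth) (auto intro!: inj_onI simp: prod_encode_eq)
  also have "(\<Sum>ki\<in>J1. (u ki)\<^sup>2) = (\<Sum>ki\<in>{ki \<in> J1. snd ki \<noteq> 0}. (x \<bullet> e (prod_encode (fst ki, snd ki - 1)))\<^sup>2)"
    using J1 by (intro sum.mono_neutral_cong_right) (auto simp: u_def E_def split: nat.splits)
  also have "\<dots> \<le> (norm x)\<^sup>2"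
    using J1 by (intro bessel_inequality orth) (auto intro!: inj_onI simp: prod_encode_eq)
  finally have "(\<Sum>j\<in>J. (x \<bullet> b j)\<^sup>2) \<le> 2 * (norm x)\<^sup>2 + 8 * (norm x)\<^sup>2"
    by simp
  moreover have "(4 * norm x)\<^sup>2 = 16 * (norm x)\<^sup>2"
    by (simp add: power_mult_distrib)
  ultimately show ?thesis
    using zero_le_power2[of "norm x"] by linarith
qed

lemma max_\<alpha>: "max (\<alpha> j) 0 = (if snd (fst j) = 0 \<and> snd j = 0 then \<sigma> (fst (fst j)) else 0)"
  using \<sigma>_pos[of "fst (fst j)"] by (cases j rule: \<alpha>.cases) (auto simp: max_def split: nat.split)

lemma offset_\<alpha>:
  assumes J: "finite J" "J \<subseteq> A"
  shows "(\<Sum>j\<in>J. (max (\<alpha> j) 0)\<^sup>2) \<le> 1"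
proof -
  define J' where "J' = {j \<in> J. snd (fst j) = 0 \<and> snd j = 0}"
  have "(\<Sum>j\<in>J. (max (\<alpha> j) 0)\<^sup>2) = (\<Sum>j\<in>J'. (\<sigma> (fst (fst j)))\<^sup>2)"
    using J by (intro sum.mono_neutral_cong_right) (auto simp: J'_def max_\<alpha> simp del: \<alpha>.simps)
  also have "\<dots> = (\<Sum>k\<in>(fst \<circ> fst) ` J'. (\<sigma> k)\<^sup>2)"
    by (subst sum.reindex) (auto intro!: inj_onI simp: J'_def)
  also have "\<dots> \<le> 1"
    using J by (intro \<sigma>_sum) (auto simp: J'_def)
  finally show ?thesis .
qed

sublocale ridge_sum A c \<alpha> b p 4
proof
  show "\<bar>c j\<bar> * (fact (p + 1) * 4 ^ (p + 1)) \<le> 1" for j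
    by (cases j rule: c.cases) (simp add: \<eta>_def del: fact_Suc power_Suc)
qed (use p bessel_b offset_\<alpha> in auto)

lemma summand_0: "summand 0 x [] j = c j * pospow (p + 1) (\<alpha> j + x \<bullet> b j)"
  by (simp add: summand_def weight_def)

text \<open>The only negative term is the power of \<open>y\<close>. Once \<open>y\<close> exceeds
  \<open>2 * \<sigma> k\<close>, it is outweighed by the power of
  \<open>2 * y - 2 * \<sigma> k\<close>, which is then at least as large.\<close>

lemma summand_block_lower:
  "(\<Sum>q<4. summand 0 x [] ((k, i), q)) \<ge> - (\<eta> * (2 * \<sigma> k) ^ (p + 1))"
proof -
  define y where "y = x \<bullet> E k i"
  have "pospow (p + 1) y \<le> (2 * \<sigma> k) ^ (p + 1) + pospow (p + 1) (2 * y - 2 * \<sigma> k)"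
  proof (cases "y \<le> 2 * \<sigma> k")
    case True
    then have "pospow (p + 1) y \<le> pospow (p + 1) (2 * \<sigma> k)"
      by (rule pospow_mono)
    also have "\<dots> = (2 * \<sigma> k) ^ (p + 1)"
      using \<sigma>_pos[of k] by (simp add: pospow_def max_def)
    finally show ?thesis
      using pospow_nonneg[of "p + 1" "2 * y - 2 * \<sigma> k"] by linarith
  next
    case False
    then have "pospow (p + 1) y \<le> pospow (p + 1) (2 * y - 2 * \<sigma> k)"
      by (intro pospow_mono) auto
    moreover have "0 \<le> (2 * \<sigma> k) ^ (p + 1)"
      using \<sigma>_pos[of k] by (intro zero_le_power) auto
    ultimately show ?thesis
      by linarith
  qed
  moreover have "0 \<le> pospow (p + 1) (\<alpha> ((k, i), 0) + x \<bullet> b ((k, i), 0))" "0 \<le> pospow (p + 1) (- y)"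
    by simp_all
  ultimately have "- ((2 * \<sigma> k) ^ (p + 1)) \<le> pospow (p + 1) (\<alpha> ((k, i), 0) + x \<bullet> b ((k, i), 0))
      + pospow (p + 1) (- y) - pospow (p + 1) y + pospow (p + 1) (2 * y - 2 * \<sigma> k)" (is "_ \<le> ?S")
    by linarith
  then have "\<eta> * (- ((2 * \<sigma> k) ^ (p + 1))) \<le> \<eta> * ?S"
    using \<eta>_pos by (intro mult_left_mono) auto
  also have "\<eta> * ?S = (\<Sum>q<4. summand 0 x [] ((k, i), q))"
    by (simp add: sum_4 summand_0 y_def algebra_simps del: power_Suc)
  finally show ?thesis
    by simp
qed

lemma ridge_lower: "- 1 \<le> ridge x"
proof -
  define g where "g ki = (\<Sum>q<4. summand 0 x [] (ki, q))" for ki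
  have s: "summand 0 x [] summable_on A"
    by (rule summand_summable) auto
  have s': "(\<lambda>(ki, q). summand 0 x [] (ki, q)) summable_on (SIGMA ki:I. {..<4})"
    using s by (simp add: A_def case_prod_unfold)
  have ridge: "ridge x = infsum g I"
    using infsum_Sigma'_banach[OF s'] unfolding A_def[symmetric]
    by (simp add: ridge_def form_def g_def[abs_def] case_prod_unfold)
  have g: "g summable_on I"
    using summable_on_Sigma_banach[OF s'] by (simp add: g_def[abs_def])
  have "infsum (\<lambda>ki. - g ki) I \<le> 1"
  proof (rule infsum_le_finite_sums)
    show "(\<lambda>ki. - g ki) summable_on I"
      using g by (simp add: summable_on_uminus)
    fix F assume F: "finite F" "F \<subseteq> I"
    have "(\<Sum>ki\<in>F. - g ki) \<le> (\<Sum>(k, i)\<in>F. \<eta> * (2 * \<sigma> k) ^ (p + 1))"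
    proof (intro sum_mono)
      show "- g ki \<le> (case ki of (k, i) \<Rightarrow> \<eta> * (2 * \<sigma> k) ^ (p + 1))" for ki
        using summand_block_lower[where k = "fst ki" and i = "snd ki" and x = x]
        unfolding g_def case_prod_unfold prod.collapse by linarith
    qed
    \<comment> \<open>The finite set is enlarged to full blocks, whose sums are those in
      \<open>drop_sum\<close>.\<close>
    also have "\<dots> \<le> (\<Sum>(k, i)\<in>(SIGMA k:fst ` F. {..N k}). \<eta> * (2 * \<sigma> k) ^ (p + 1))"
      using F \<eta>_pos less_imp_le[OF \<sigma>_pos]
      by (intro sum_mono2) (auto simp: I_def image_iff Bex_def)
    also have "\<dots> = (\<Sum>k\<in>fst ` F. (\<Sum>i\<le>N k. \<eta> * (2 * \<sigma> k) ^ (p + 1)))"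
      using F by (subst sum.Sigma) auto
    also have "\<dots> = \<eta> * 2 ^ (p + 1) * (\<Sum>k\<in>fst ` F. (real (N k) + 1) * \<sigma> k ^ (p + 1))"
      by (simp add: sum_distrib_left power_mult_distrib mult_ac add_ac)
    also have "\<dots> \<le> 1 * 1"
    proof (intro mult_mono drop_sum)
      have "(4 :: real) ^ (p + 1) = 2 ^ (p + 1) * 2 ^ (p + 1)"
        by (subst power_mult_distrib[symmetric]) simp
      then have "\<eta> * 2 ^ (p + 1) = (1 / fact (p + 1)) * (1 / 2) ^ (p + 1)"
        by (simp add: \<eta>_def power_one_over divide_simps del: fact_Suc power_Suc)
      also have "\<dots> \<le> 1 * 1"
        by (intro mult_mono power_le_one) (auto simp: divide_le_eq_1 simp del: fact_Suc)
      finally show "\<eta> * 2 ^ (p + 1) \<le> 1"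
        by simp
      show "0 \<le> (\<Sum>k\<in>fst ` F. (real (N k) + 1) * \<sigma> k ^ (p + 1))"
        using less_imp_le[OF \<sigma>_pos] by (intro sum_nonneg mult_nonneg_nonneg zero_le_power) auto
    qed (use F in auto)
    finally show "(\<Sum>ki\<in>F. - g ki) \<le> 1"
      by simp
  qed
  then show ?thesis
    using ridge by (simp add: infsum_uminus)
qed

lemma ridge_F_ncvx: "ridge \<in> F_ncvx p"
  by (rule ridge_in_F_ncvx) (rule ridge_lower)

section \<open>The gradient of a block and the order in which coordinates are discovered\<close>

lemma inner_b_nonzero:
  assumes "E k i \<bullet> b ((k', i'), q) \<noteq> 0"
  shows "k' = k \<and> (i' = i \<or> i' = Suc i \<and> q = 0)"
  using assms by (cases i') (simp_all add: inner_diff_right E_inner split: if_splits)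

text \<open>Coordinate \<open>i\<close> meets the four labels of its own position
  (\<open>S1\<close>) and the descent term of its successor (\<open>S2\<close>), which is missing at
  the end of the block. This is the expression studied in \<open>chain_gradient\<close>.\<close>

lemma partial_ridge:
  fixes x :: 'a
  assumes "i \<le> N k"
  defines "d \<equiv> \<lambda>i. (case i of 0 \<Rightarrow> \<sigma> k | Suc i' \<Rightarrow> x \<bullet> E k i') - x \<bullet> E k i"
  shows "form 1 x [E k i] = \<eta> * real (p + 1) *
    ((if i < N k then pospow p (d (Suc i)) else 0) - pospow p (d i)
      - pospow p (- (x \<bullet> E k i)) - pospow p (x \<bullet> E k i) + 2 * pospow p (2 * (x \<bullet> E k i) - 2 * \<sigma> k))"
proof -
  define S1 where "S1 = {((k, i), 0), ((k, i), 1), ((k, i), 2), ((k, i), 3::nat)}"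
  define S2 where "S2 = (if i < N k then {((k, Suc i), 0::nat)} else {})"
  have sm: "summand (Suc 0) x [E k i] j = c j * real (p + 1) * pospow p (\<alpha> j + x \<bullet> b j) * (E k i \<bullet> b j)" for j
    by (simp add: summand_def weight_def)
  have d0: "\<alpha> ((k, i), 0) + x \<bullet> b ((k, i), 0) = d i" for i
    by (cases i) (simp_all add: d_def inner_diff_right)
  have E0: "E k i \<bullet> b ((k, i), 0) = -1"
    by (cases i) (simp_all add: inner_diff_right E_inner)
  have "form 1 x [E k i] = infsum (summand 1 x [E k i]) (S1 \<union> S2)"
    unfolding form_def
  proof (rule infsum_cong_neutral)
    fix j assume j: "j \<in> A - (S1 \<union> S2)"
    obtain k' i' q where j': "j = ((k', i'), q)"
      by (metis prod.collapse)
    have "E k i \<bullet> b j = 0"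
    proof (rule ccontr)
      assume "E k i \<bullet> b j \<noteq> 0"
      then have "k' = k" "i' = i \<or> i' = Suc i \<and> q = 0"
        using inner_b_nonzero unfolding j' by blast+
      moreover have "q = 0 \<or> q = 1 \<or> q = 2 \<or> q = 3" "i' \<le> N k'"
        using j unfolding j' by (auto simp: A_def I_def)
      ultimately show False
        using j unfolding j' by (auto simp: S1_def S2_def)
    qed
    then show "summand 1 x [E k i] j = 0"
      by (simp add: sm)
  qed (use assms in \<open>auto simp: A_def I_def S1_def S2_def split: if_splits\<close>)
  also have "\<dots> = sum (summand 1 x [E k i]) S1 + sum (summand 1 x [E k i]) S2"
    by (subst infsum_finite) (auto intro!: sum.union_disjoint simp: S1_def S2_def)
  also have "sum (summand 1 x [E k i]) S2 = (if i < N k then \<eta> * real (p + 1) * pospow p (d (Suc i)) else 0)"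
    using d0[of "Suc i"] by (simp add: S2_def sm inner_diff_right E_inner)
  also have "sum (summand 1 x [E k i]) S1 = \<eta> * real (p + 1) * (- pospow p (d i)
      - pospow p (- (x \<bullet> E k i)) - pospow p (x \<bullet> E k i) + 2 * pospow p (2 * (x \<bullet> E k i) - 2 * \<sigma> k))"
    using d0[of i] E0 by (simp add: S1_def sm E_inner algebra_simps)
  finally show ?thesis
    by (simp add: algebra_simps)
qed

lemma form_norm_gradient_lower:
  assumes "x \<bullet> E k (N k) = 0"
  shows "\<eta> * real (p + 1) * ((1/8) ^ p / 16) * \<sigma> k ^ p \<le> form_norm 1 (nabla 1 ridge x)"
proof -
  obtain i where i: "i \<le> N k" and G: "\<sigma> k ^ p * ((1/8) ^ p / 16) \<le>
     \<bar>(if i < N k then pospow p ((case Suc i of 0 \<Rightarrow> \<sigma> k | Suc i' \<Rightarrow> x \<bullet> E k i') - x \<bullet> E k (Suc i)) else 0)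
       - pospow p ((case i of 0 \<Rightarrow> \<sigma> k | Suc i' \<Rightarrow> x \<bullet> E k i') - x \<bullet> E k i)
       - pospow p (- (x \<bullet> E k i)) - pospow p (x \<bullet> E k i) + 2 * pospow p (2 * (x \<bullet> E k i) - 2 * \<sigma> k)\<bar>"
    (is "_ \<le> \<bar>?G\<bar>")
    using chain_gradient[OF p \<sigma>_pos[of k], of "\<lambda>i. x \<bullet> E k i", OF assms] by blast
  have "\<eta> * real (p + 1) * (\<sigma> k ^ p * ((1/8) ^ p / 16)) \<le> \<eta> * real (p + 1) * \<bar>?G\<bar>"
    using G \<eta>_pos by (intro mult_left_mono) auto
  also have "\<dots> = \<bar>form 1 x [E k i]\<bar>"
    unfolding partial_ridge[OF i] abs_mult[of "\<eta> * real (p + 1)"] using \<eta>_pos by simp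
  also have "\<dots> \<le> form_norm 1 (nabla 1 ridge x)"
    by (rule abs_partial_le_form_norm) (simp add: norm_E)
  finally show ?thesis
    by (simp add: mult_ac)
qed

text \<open>Every summand involving \<open>E k i\<close> has argument at most 0 at \<open>x\<close>:
  as \<open>t < i\<close>, the predecessor of \<open>i\<close> vanishes too, so the descents are 0.
  For \<open>r \<le> p\<close> a positive exponent remains, so the summand is 0.\<close>

lemma form_undiscovered:
  assumes x: "\<And>i. t \<le> i \<Longrightarrow> i \<le> N k \<Longrightarrow> x \<bullet> E k i = 0"
    and i: "t < i" "i \<le> N k" and r: "r \<le> p"
  shows "form r x (E k i # us) = 0"
  unfolding form_def
proof (rule infsum_0)
  fix j assume j: "j \<in> A"
  obtain k' i' q where j': "j = ((k', i'), q)"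
    by (metis prod.collapse)
  have "E k i \<bullet> b j = 0 \<or> \<alpha> j + x \<bullet> b j \<le> 0"
  proof (cases "k' = k \<and> (i' = i \<or> i' = Suc i \<and> q = 0)")
    case True
    then show ?thesis
      using i j x[of i] x[of "i - 1"] x[of "Suc i"] \<sigma>_pos[of k] unfolding j'
      by (auto simp: A_def I_def inner_diff_right split: nat.splits)
  next
    case False
    then show ?thesis
      using inner_b_nonzero unfolding j' by blast
  qed
  then show "summand r x (E k i # us) j = 0"
    using r by (auto simp: summand_def pospow_nonpos)
qed

text \<open>The first iterate is 0, and each query reveals at most one further position of every
  block. Testing the first slot of the derivative suffices, because \<open>tensor_supp\<close>
  refers to that slot.\<close>

lemma zero_respecting_undiscovered:
  assumes zr: "zero_respecting e p ridge x"
  shows "1 \<le> t \<Longrightarrow> t - 1 \<le> i \<Longrightarrow> i \<le> N k \<Longrightarrow> x t \<bullet> E k i = 0"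
proof (induction t arbitrary: i rule: less_induct)
  case (less t)
  show ?case
  proof (rule ccontr)
    assume "x t \<bullet> E k i \<noteq> 0"
    then have "prod_encode (k, i) \<in> supp e (x t)"
      by (simp add: supp_def E_def)
    then obtain r s js where r: "r \<in> {1..p}" and s: "s \<in> {1..<t}"
      and len: "length (prod_encode (k, i) # js) = r"
      and nz: "nabla r ridge (x s) (map e (prod_encode (k, i) # js)) \<noteq> 0"
      using zr less.prems unfolding zero_respecting_def tensor_supp_def by blast
    \<comment> \<open>By induction the positions from \<open>s - 1\<close> on vanish at
      \<open>x s\<close>, and \<open>s - 1 < s \<le> t - 1 \<le> i\<close>.\<close>
    have "form r (x s) (E k i # map e js) = 0"
      using less r s by (intro form_undiscovered[where t = "s - 1"]) auto
    then show False
      using nz r len by (simp add: nabla_ridge E_def del: nabla.simps)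
  qed
qed

text \<open>Iterate \<open>N k + 1\<close> is the output after \<open>N k\<close> calls. Position
  \<open>N k\<close>, the last one of block \<open>k\<close>, is just out of reach for it.\<close>

lemma algorithm_gradient_lower:
  assumes "Alg \<in> A_zr e p"
  shows "\<eta> * real (p + 1) * ((1/8) ^ p / 16) * \<sigma> k ^ p \<le> form_norm 1 (nabla 1 ridge (Alg ridge (N k + 1)))"
proof (rule form_norm_gradient_lower)
  have "zero_respecting e p ridge (Alg ridge)"
    using assms times_differentiable_ridge by (auto simp: A_zr_def)
  then show "Alg ridge (N k + 1) \<bullet> E k (N k) = 0"
    by (rule zero_respecting_undiscovered) auto
qed

end

section \<open>Choice of the block lengths and scales for a given rate\<close>

lemma antimono_bij_eventually_small:
  fixes \<rho> :: "real \<Rightarrow> real"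
  assumes bij: "bij_betw \<rho> {1..} {0<..1}" and anti: "antimono_on {1..} \<rho>" and \<delta>: "0 < \<delta>"
  shows "\<exists>n\<ge>m. 1 \<le> n \<and> 0 < \<rho> (real n) \<and> \<rho> (real n) \<le> \<delta>"
proof -
  have "min 1 \<delta> \<in> \<rho> ` {1..}"
    using bij \<delta> by (auto simp: bij_betw_def)
  then obtain y where y: "1 \<le> y" "\<rho> y = min 1 \<delta>"
    by force
  define n where "n = max m (nat \<lceil>y\<rceil>)"
  have yn: "y \<le> real n"
    unfolding n_def by linarith
  then have "\<rho> (real n) \<le> \<rho> y"
    using anti y(1) by (auto simp: monotone_on_def)
  moreover have "\<rho> (real n) \<in> {0<..1}"
    using bij y(1) yn by (auto simp: bij_betw_def)
  ultimately show ?thesis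
    using y yn by (intro exI[of _ n]) (auto simp: n_def)
qed

lemma sum_half_powers: "finite K \<Longrightarrow> (\<Sum>k\<in>K. (1/2) ^ Suc k) \<le> (1::real)"
proof -
  assume "finite K"
  then obtain M where M: "K \<subseteq> {..<M}"
    by (meson finite_nat_iff_bounded)
  have "(\<Sum>k\<in>K. (1/2) ^ Suc k) \<le> (\<Sum>k<M. (1/2 :: real) ^ Suc k)"
    using M by (intro sum_mono2) auto
  also have "\<dots> = 1 - (1/2) ^ M"
    by (induction M) auto
  finally show ?thesis
    by (smt (verit) zero_le_power divide_nonneg_nonneg)
qed

theorem corollary1:
  fixes e :: "nat \<Rightarrow> 'a::{real_inner, complete_space}"
    and \<rho> :: "real \<Rightarrow> real"
    and p :: nat
  assumes "orthonormal_basis e"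
    and "bij_betw \<rho> {1..} {0<..1}"
    and "antimono_on {1..} \<rho>"
    and "p \<ge> 1"
  shows "\<exists>F \<in> F_ncvx p.
    limsup (\<lambda>n::nat. INF A\<in>A_zr e p.
      ereal (real n powr (real p / real (p + 1)) * form_norm 1 (nabla 1 F (A F (n + 1))) / \<rho> (real n))) \<ge> 1"
proof -
  \<comment> \<open>The constant of \<open>algorithm_gradient_lower\<close> with
    \<open>\<eta>\<close> unfolded. It depends on \<open>p\<close> only, so it can be fixed before
    the blocks are chosen.\<close>
  define \<kappa> :: real where "\<kappa> = 1 / (fact (p + 1) * 4 ^ (p + 1)) * real (p + 1) * ((1/8) ^ p / 16)"
  have \<kappa>: "0 < \<kappa>"
    unfolding \<kappa>_def by (intro mult_pos_pos divide_pos_pos) auto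
  \<comment> \<open>The smallness of the rate makes \<open>\<tau> k \<le> (1/2) ^ Suc k\<close>, and
    \<open>n \<ge> k\<close> places some \<open>N k\<close> in every tail of the limsup.\<close>
  have "\<exists>n\<ge>k. 1 \<le> n \<and> 0 < \<rho> (real n) \<and> \<rho> (real n) \<le> \<kappa> * ((1/2) ^ Suc k) ^ p" for k
    using \<kappa> by (intro antimono_bij_eventually_small[OF assms(2,3)]) auto
  then obtain N where N: "k \<le> N k" "1 \<le> N k" "0 < \<rho> (real (N k))"
      "\<rho> (real (N k)) \<le> \<kappa> * ((1/2) ^ Suc k) ^ p" for k
    by metis
  \<comment> \<open>The scale is split in two. \<open>\<nu> k ^ (p + 1)\<close> is the inverse of
    \<open>N k\<close> and cancels the block length in the decrease; \<open>\<tau> k ^ p\<close>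
    carries the rate, so that \<open>\<kappa> * \<sigma> k ^ p\<close> is exactly the required lower
    bound on the gradient.\<close>
  define \<tau> where "\<tau> k = root p (\<rho> (real (N k)) / \<kappa>)" for k
  define \<nu> where "\<nu> k = real (N k) powr (- 1 / real (p + 1))" for k
  define \<sigma> where "\<sigma> k = \<tau> k * \<nu> k" for k
  have \<tau>_pos: "0 < \<tau> k" for k
    using N(3)[of k] \<kappa> assms(4) by (simp add: \<tau>_def)
  have \<tau>_pow: "\<tau> k ^ p = \<rho> (real (N k)) / \<kappa>" for k
    using N(3)[of k] \<kappa> assms(4) by (simp add: \<tau>_def)
  have \<tau>_le: "\<tau> k \<le> (1/2) ^ Suc k" for k
  proof -
    have "\<tau> k ^ p \<le> ((1/2) ^ Suc k) ^ p"
      unfolding \<tau>_pow using N(4)[of k] \<kappa> by (simp add: divide_le_eq mult_ac del: power_Suc)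
    then show ?thesis
      using assms(4) \<tau>_pos[of k] by (subst (asm) power_mono_iff) auto
  qed
  have \<nu>_pos: "0 < \<nu> k" for k
    using N(2)[of k] by (simp add: \<nu>_def)
  have \<nu>_pow: "\<nu> k ^ m = real (N k) powr (- (real m / real (p + 1)))" for k m
    using N(2)[of k] by (simp add: \<nu>_def powr_powr flip: powr_realpow)
  have \<nu>_Suc: "\<nu> k ^ (p + 1) = 1 / real (N k)" for k
    using N(2)[of k] unfolding \<nu>_pow by (simp add: powr_minus divide_inverse)
  have \<nu>_le: "\<nu> k \<le> 1" for k
    using N(2)[of k] powr_mono[of "- 1 / real (p + 1)" 0 "real (N k)"] by (simp add: \<nu>_def)
  have \<sigma>_pos: "0 < \<sigma> k" for k
    using \<tau>_pos \<nu>_pos by (simp add: \<sigma>_def)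
  \<comment> \<open>The extra factor 1/2 compensates for the quotient of \<open>N k + 1\<close> by
    \<open>N k\<close>, which can be as large as 2.\<close>
  have \<tau>_sq: "(\<tau> k)\<^sup>2 \<le> (1/2) ^ Suc k * (1/2)" for k
  proof -
    have "(1/2 :: real) ^ Suc k \<le> 1/2"
      by (simp add: power_le_one)
    then have "\<tau> k * \<tau> k \<le> (1/2) ^ Suc k * (1/2)"
      using \<tau>_le[of k] \<tau>_pos[of k] by (intro mult_mono) auto
    then show ?thesis
      by (simp add: power2_eq_square)
  qed
  have \<sigma>_sq: "(\<sigma> k)\<^sup>2 \<le> (1/2) ^ Suc k" for k
  proof -
    have "(\<sigma> k)\<^sup>2 \<le> (\<tau> k)\<^sup>2"
      using \<nu>_le[of k] \<nu>_pos[of k] \<tau>_pos[of k] by (intro power_mono) (auto simp: \<sigma>_def mult_le_cancel_left1)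
    then show ?thesis
      using \<tau>_sq[of k] zero_le_power[of "1/2::real" "Suc k"] by linarith
  qed
  have drop: "(real (N k) + 1) * \<sigma> k ^ (p + 1) \<le> (1/2) ^ Suc k" for k
  proof -
    have "(real (N k) + 1) * \<sigma> k ^ (p + 1) = \<tau> k ^ (p + 1) * ((real (N k) + 1) / real (N k))"
      unfolding \<sigma>_def power_mult_distrib \<nu>_Suc by simp
    also have "\<dots> \<le> (\<tau> k)\<^sup>2 * 2"
    proof (intro mult_mono)
      have "\<tau> k \<le> 1"
        using \<tau>_le[of k] power_le_one[of "1/2::real" "Suc k"] by linarith
      then show "\<tau> k ^ (p + 1) \<le> (\<tau> k)\<^sup>2"
        using \<tau>_pos[of k] assms(4) by (intro power_decreasing) auto
      show "(real (N k) + 1) / real (N k) \<le> 2"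
        using N(2)[of k] by (simp add: divide_le_eq)
    qed auto
    also have "\<dots> \<le> (1/2) ^ Suc k"
      using \<tau>_sq[of k] by simp
    finally show ?thesis .
  qed
  interpret hard_function e p N \<sigma>
  proof
    show "e i \<bullet> e j = (if i = j then 1 else 0)" for i j
      using assms(1) by (simp add: orthonormal_basis_def)
    show "(\<Sum>k\<in>K. (\<sigma> k)\<^sup>2) \<le> 1" if "finite K" for K
      using sum_mono[of K, OF \<sigma>_sq] sum_half_powers[OF that] by (rule order_trans)
    show "(\<Sum>k\<in>K. (real (N k) + 1) * \<sigma> k ^ (p + 1)) \<le> 1" if "finite K" for K
      using sum_mono[of K, OF drop] sum_half_powers[OF that] by (rule order_trans)
  qed (use assms(4) \<sigma>_pos in auto)
  let ?u = "\<lambda>n::nat. INF A\<in>A_zr e p.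
    ereal (real n powr (real p / real (p + 1)) * form_norm 1 (nabla 1 ridge (A ridge (n + 1))) / \<rho> (real n))"
  have u: "1 \<le> ?u (N k)" for k
  proof (rule INF_greatest)
    fix Alg assume Alg: "Alg \<in> A_zr e p"
    let ?w = "real (N k) powr (real p / real (p + 1))"
    have w: "0 < ?w"
      using N(2)[of k] by simp
    have "\<nu> k ^ p = 1 / ?w"
      unfolding \<nu>_pow by (simp add: powr_minus divide_inverse)
    then have "?w * (\<kappa> * \<sigma> k ^ p) = \<rho> (real (N k))"
      using w \<kappa> by (simp add: \<sigma>_def power_mult_distrib \<tau>_pow)
    moreover have "?w * (\<kappa> * \<sigma> k ^ p) \<le> ?w * form_norm 1 (nabla 1 ridge (Alg ridge (N k + 1)))"
      using algorithm_gradient_lower[OF Alg, of k] w unfolding \<kappa>_def \<eta>_def by (intro mult_left_mono) auto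
    ultimately have "1 \<le> ?w * form_norm 1 (nabla 1 ridge (Alg ridge (N k + 1))) / \<rho> (real (N k))"
      using N(3)[of k] by (simp add: le_divide_eq)
    then show "1 \<le> ereal (?w * form_norm 1 (nabla 1 ridge (Alg ridge (N k + 1))) / \<rho> (real (N k)))"
      by (simp add: one_ereal_def)
  qed
  have "1 \<le> limsup ?u"
    unfolding limsup_INF_SUP
  proof (rule INF_greatest)
    fix k
    show "1 \<le> (SUP m\<in>{k..}. ?u m)"
      using u N(1) by (intro SUP_upper2[of "N k"]) auto
  qed
  then show ?thesis
    using ridge_F_ncvx by blast
qed

end
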